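(* Let $R=\Bbbk[x_1,\dots,x_n]$ and let $I=\prod_{j=1}^s I_j^{[p_j]}$ be a special ideal, with $I_j=(x_1,\dots,x_{\ell_j})^{a_j}$ and $I_j^{[p_j]}=(x_1^{p_j},\dots,x_{\ell_j}^{p_j})^{a_j}$. Set $J_1=I_1^{[p_1]}$ and $J_k=I_k^{[p_k]}J_{k-1}$ for $2\le k\le s$ (so $J_s=I$). Then for each $k=2,\dots,s$, starting from the minimal graded free resolution of $R/J_{k-1}$, the reduced horseshoe resolution of $R/J_k$ with respect to the ordered pair $(I_k^{[p_k]},J_{k-1})$ is a minimal graded free resolution of $R/J_k$. In particular, the iterated reduced horseshoe resolution of $R/I$ with respect to $(I_s^{[p_s]},\dots,I_1^{[p_1]})$ is minimal.
   Context: A special ideal over $R$ is $I=\prod_{j=1}^s I_j^{[p_j]}$ where $I_j=(x_1,\dots,x_{\ell_j})^{a_j}$, $I_j^{[p_j]}=(x_1^{p_j},\dots,x_{\ell_j}^{p_j})^{a_j}$, $n=\ell_1\ge\ell_2\ge\cdots\ge\ell_s\ge1$, the $p_j$ are positive integers such that $p_{j+1}/p_j$ is an integer $>1$ for $1\le j\le s-1$, and the $a_j$ are integers with $0\le a_j<p_{j+1}/p_j$ for $1\le j\le s-1$ (and $a_s\ge0$). Reduced horseshoe resolution of $R/AB$ with respect to the pair $(A,B)$ (with $A\supseteq AB$): let $\cdots\to F_2\xrightarrow{d''_2}F_1\xrightarrow{d''_1}R\to R/A\to0$ be the minimal graded free resolution of $R/A$ and $\cdots\to G_2\xrightarrow{d'_2}G_1\xrightarrow{d'_1}G_0=F_1\to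 A/AB\to0$ a minimal graded free resolution of $A/AB$ with augmentation induced by $d''_1$. The horseshoe lemma for $0\to A/AB\to R/AB\to R/A\to0$ gives degree-$0$ graded maps $\lambda_k:F_k\to G_{k-1}$ with $\lambda_1=-\mathrm{id}_{F_1}$ and $d'_{k-1}\lambda_k+\lambda_{k-1}d''_k=0$ for $k>1$. The reduced horseshoe resolution is the complex $\cdots\to G_3\oplus F_3\xrightarrow{\begin{bmatrix} d'_3&\lambda_3\\0&d''_3\end{bmatrix}} G_2\oplus F_2\xrightarrow{[\,d'_2\ \lambda_2\,]}G_1\xrightarrow{d''_1\lambda_1^{-1}d'_1}R\to R/AB\to0$ (with differentials $\begin{bmatrix} d'_k&\lambda_k\\0&d''_k\end{bmatrix}$ for $k\ge3$). Minimal means no differential matrix has a nonzero constant entry. *)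

theory Defs
  imports "HOL-Library.Poly_Mapping"
begin

text \<open>Multivariate polynomials over a field: exponent vectors (finitely supported nat-valued maps),
 variable x_(i+1) is indexed by i.  R = k[x_1,...,x_n] is the set of
 polynomials involving only the variables with index < n.\<close>

type_synonym 'k mpoly = "(nat \<Rightarrow>\<^sub>0 nat) \<Rightarrow>\<^sub>0 'k"

definition polys :: "nat \<Rightarrow> ('k::field) mpoly set" where
  "polys n = {p :: 'k mpoly. \<forall>m\<in>Poly_Mapping.keys p. \<forall>i\<in>Poly_Mapping.keys m. i < n}"

definition var :: "nat \<Rightarrow> ('k::field) mpoly" where
  "var i = Poly_Mapping.single (Poly_Mapping.single i 1) 1"

definition mdeg :: "(nat \<Rightarrow>\<^sub>0 nat) \<Rightarrow> nat" where
  "mdeg m = sum (Poly_Mapping.lookup m) (Poly_Mapping.keys m)"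

text \<open>homogeneous of (integer) degree d; the zero polynomial is homogeneous of every degree\<close>
definition homog :: "('k::field) mpoly \<Rightarrow> int \<Rightarrow> bool" where
  "homog p d \<longleftrightarrow> (\<forall>m\<in>Poly_Mapping.keys p. int (mdeg m) = d)"

definition nonzero_const :: "('k::field) mpoly \<Rightarrow> bool" where
  "nonzero_const p \<longleftrightarrow> p \<noteq> 0 \<and> Poly_Mapping.keys p \<subseteq> {0}"

inductive_set ideal_gen :: "nat \<Rightarrow> ('k::field) mpoly set \<Rightarrow> 'k mpoly set"
  for n S where
  zero: "0 \<in> ideal_gen n S"
| step: "s \<in> S \<Longrightarrow> r \<in> polys n \<Longrightarrow> q \<in> ideal_gen n S \<Longrightarrow> r * s + q \<in> ideal_gen n S"

definition ideal_mult :: "nat \<Rightarrow> ('k::field) mpoly set \<Rightarrow> 'k mpoly set \<Rightarrow> 'k mpoly set" where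
  "ideal_mult n A B = ideal_gen n {a * b | a b. a \<in> A \<and> b \<in> B}"

fun ideal_pow :: "nat \<Rightarrow> ('k::field) mpoly set \<Rightarrow> nat \<Rightarrow> 'k mpoly set" where
  "ideal_pow n A 0 = polys n"
| "ideal_pow n A (Suc a) = ideal_mult n A (ideal_pow n A a)"

definition frob_ideal :: "nat \<Rightarrow> nat \<Rightarrow> nat \<Rightarrow> nat \<Rightarrow> ('k::field) mpoly set" where
  "frob_ideal n l p a = ideal_pow n (ideal_gen n {var i ^ p | i. i < l}) a"

fun J_ideal :: "nat \<Rightarrow> (nat \<Rightarrow> nat) \<Rightarrow> (nat \<Rightarrow> nat) \<Rightarrow> (nat \<Rightarrow> nat) \<Rightarrow> nat \<Rightarrow> ('k::field) mpoly set" where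
  "J_ideal n l p a 0 = polys n"
| "J_ideal n l p a (Suc 0) = frob_ideal n (l 1) (p 1) (a 1)"
| "J_ideal n l p a (Suc (Suc k)) =
     ideal_mult n (frob_ideal n (l (Suc (Suc k))) (p (Suc (Suc k))) (a (Suc (Suc k))))
                  (J_ideal n l p a (Suc k))"

definition special_data :: "nat \<Rightarrow> nat \<Rightarrow> (nat \<Rightarrow> nat) \<Rightarrow> (nat \<Rightarrow> nat) \<Rightarrow> (nat \<Rightarrow> nat) \<Rightarrow> bool" where
  "special_data n s l p a \<longleftrightarrow>
     s \<ge> 1 \<and> l 1 = n \<and> (\<forall>j. 1 \<le> j \<and> j < s \<longrightarrow> l (j+1) \<le> l j) \<and> l s \<ge> 1 \<and>
     (\<forall>j. 1 \<le> j \<and> j \<le> s \<longrightarrow> p j > 0) \<and>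
     (\<forall>j. 1 \<le> j \<and> j < s \<longrightarrow> p j dvd p (j+1) \<and> p (j+1) div p j > 1 \<and> a j < p (j+1) div p j)"

text \<open>Graded free modules F = (+)_{i<r} R(-deg i): elements are vectors of polynomials
 indexed by i < r (zero elsewhere); maps are matrices M j i (row j < target rank,
 column i < source rank).\<close>

type_synonym 'k mvec = "nat \<Rightarrow> 'k mpoly"
type_synonym 'k mmat = "nat \<Rightarrow> nat \<Rightarrow> 'k mpoly"

definition vecs :: "nat \<Rightarrow> nat \<Rightarrow> ('k::field) mvec set" where
  "vecs n r = {v. (\<forall>i<r. v i \<in> polys n) \<and> (\<forall>i\<ge>r. v i = 0)}"

definition mat_app :: "nat \<Rightarrow> nat \<Rightarrow> ('k::field) mmat \<Rightarrow> 'k mvec \<Rightarrow> 'k mvec" where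
  "mat_app m r M v = (\<lambda>j. if j < m then (\<Sum>i<r. M j i * v i) else 0)"

definition mat_mult :: "nat \<Rightarrow> ('k::field) mmat \<Rightarrow> 'k mmat \<Rightarrow> 'k mmat" where
  "mat_mult t M N = (\<lambda>j i. \<Sum>u<t. M j u * N u i)"

definition kern :: "nat \<Rightarrow> nat \<Rightarrow> nat \<Rightarrow> ('k::field) mmat \<Rightarrow> 'k mvec set" where
  "kern n m r M = {v \<in> vecs n r. mat_app m r M v = (\<lambda>_. 0)}"

definition img :: "nat \<Rightarrow> nat \<Rightarrow> nat \<Rightarrow> ('k::field) mmat \<Rightarrow> 'k mvec set" where
  "img n m r M = mat_app m r M ` vecs n r"

definition graded_map :: "nat \<Rightarrow> nat \<Rightarrow> (nat \<Rightarrow> int) \<Rightarrow> nat \<Rightarrow> (nat \<Rightarrow> int) \<Rightarrow> ('k::field) mmat \<Rightarrow> bool" where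
  "graded_map n r dr m dm M \<longleftrightarrow>
     (\<forall>j<m. \<forall>i<r. M j i \<in> polys n \<and> homog (M j i) (dr i - dm j))"

text \<open>(r,dg,d) is a graded free resolution of F_0 / U, where F_0 has rank r 0 and
 shifts dg 0:  ... -> F_2 -d_2-> F_1 -d_1-> F_0 -> F_0/U -> 0 is exact.\<close>
definition graded_free_res ::
  "nat \<Rightarrow> (nat \<Rightarrow> nat) \<Rightarrow> (nat \<Rightarrow> nat \<Rightarrow> int) \<Rightarrow> (nat \<Rightarrow> ('k::field) mmat) \<Rightarrow> 'k mvec set \<Rightarrow> bool" where
  "graded_free_res n r dg d U \<longleftrightarrow>
     (\<forall>k\<ge>1. graded_map n (r k) (dg k) (r (k-1)) (dg (k-1)) (d k)) \<and>
     (\<forall>k\<ge>1. kern n (r (k-1)) (r k) (d k) = img n (r k) (r (k+1)) (d (k+1))) \<and>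
     img n (r 0) (r 1) (d 1) = U"

definition minimal_cx :: "(nat \<Rightarrow> nat) \<Rightarrow> (nat \<Rightarrow> ('k::field) mmat) \<Rightarrow> bool" where
  "minimal_cx r d \<longleftrightarrow> (\<forall>k\<ge>1. \<forall>j<r (k-1). \<forall>i<r k. \<not> nonzero_const (d k j i))"

definition minimal_graded_free_res ::
  "nat \<Rightarrow> (nat \<Rightarrow> nat) \<Rightarrow> (nat \<Rightarrow> nat \<Rightarrow> int) \<Rightarrow> (nat \<Rightarrow> ('k::field) mmat) \<Rightarrow> 'k mvec set \<Rightarrow> bool" where
  "minimal_graded_free_res n r dg d U \<longleftrightarrow> graded_free_res n r dg d U \<and> minimal_cx r d"

definition ideal_vecs :: "nat \<Rightarrow> ('k::field) mpoly set \<Rightarrow> 'k mvec set" where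
  "ideal_vecs n I = {v \<in> vecs n 1. v 0 \<in> I}"

definition cyclic_res ::
  "nat \<Rightarrow> (nat \<Rightarrow> nat) \<Rightarrow> (nat \<Rightarrow> nat \<Rightarrow> int) \<Rightarrow> (nat \<Rightarrow> ('k::field) mmat) \<Rightarrow> 'k mpoly set \<Rightarrow> bool" where
  "cyclic_res n r dg d I \<longleftrightarrow> r 0 = 1 \<and> dg 0 0 = 0 \<and> minimal_graded_free_res n r dg d (ideal_vecs n I)"

definition horseshoe_maps ::
  "nat \<Rightarrow> (nat \<Rightarrow> nat) \<Rightarrow> (nat \<Rightarrow> nat \<Rightarrow> int) \<Rightarrow> (nat \<Rightarrow> ('k::field) mmat) \<Rightarrow>
   (nat \<Rightarrow> nat) \<Rightarrow> (nat \<Rightarrow> nat \<Rightarrow> int) \<Rightarrow> (nat \<Rightarrow> 'k mmat) \<Rightarrow> (nat \<Rightarrow> 'k mmat) \<Rightarrow> bool" where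
  "horseshoe_maps n fr fdg d2 gr gdg d1 lam \<longleftrightarrow>
     (\<forall>k\<ge>1. graded_map n (fr k) (fdg k) (gr (k-1)) (gdg (k-1)) (lam k)) \<and>
     (\<forall>j<fr 1. \<forall>i<fr 1. lam 1 j i = (if j = i then -1 else 0)) \<and>
     (\<forall>k>1. \<forall>j<gr (k-2). \<forall>i<fr k.
        mat_mult (gr (k-1)) (d1 (k-1)) (lam k) j i + mat_mult (fr (k-1)) (lam (k-1)) (d2 k) j i = 0)"

text \<open>The reduced horseshoe complex: H_0 = R, H_1 = G_1, H_k = G_k (+) F_k (k \<ge> 2).
 Here d2 = d'' (resolution F of R/A), d1 = d' (resolution G of A/AB),
 and d''_1 lambda_1^{-1} d'_1 = - d''_1 d'_1 since lambda_1 = -id.\<close>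
definition rh_rank :: "(nat \<Rightarrow> nat) \<Rightarrow> (nat \<Rightarrow> nat) \<Rightarrow> nat \<Rightarrow> nat" where
  "rh_rank fr gr k = (if k = 0 then 1 else if k = 1 then gr 1 else gr k + fr k)"

definition rh_deg :: "(nat \<Rightarrow> nat \<Rightarrow> int) \<Rightarrow> (nat \<Rightarrow> nat) \<Rightarrow> (nat \<Rightarrow> nat \<Rightarrow> int) \<Rightarrow> nat \<Rightarrow> nat \<Rightarrow> int" where
  "rh_deg fdg gr gdg k i = (if k = 0 then 0 else if k = 1 then gdg 1 i
      else if i < gr k then gdg k i else fdg k (i - gr k))"

definition rh_diff ::
  "(nat \<Rightarrow> nat) \<Rightarrow> (nat \<Rightarrow> ('k::field) mmat) \<Rightarrow> (nat \<Rightarrow> nat) \<Rightarrow> (nat \<Rightarrow> 'k mmat) \<Rightarrow>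
   (nat \<Rightarrow> 'k mmat) \<Rightarrow> nat \<Rightarrow> 'k mmat" where
  "rh_diff fr d2 gr d1 lam k j i =
     (if k = 1 then - mat_mult (fr 1) (d2 1) (d1 1) j i
      else if k = 2 then (if i < gr 2 then d1 2 j i else lam 2 j (i - gr 2))
      else if j < gr (k-1) then (if i < gr k then d1 k j i else lam k j (i - gr k))
      else (if i < gr k then 0 else d2 k (j - gr (k-1)) (i - gr k)))"

end

theory Submission
  imports Defs
begin

text \<open>
  Write \<open>q = p_k\<close>, \<open>A = (x_1^q, \<dots>, x_l^q)^a\<close> and \<open>B = J_{k-1}\<close>.  Exactness of the reduced
  horseshoe complex is a diagram chase; the point is that no \<open>\<lambda>_k\<close> with \<open>k \<ge> 2\<close> has a nonzero
  constant entry.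

  The maps \<open>\<lambda>_k\<close>, \<open>k \<ge> 2\<close>, lift the inclusion of \<open>Z = im d''_2\<close> into \<open>U = im d'_1\<close>.  Since \<open>F\<close>
  and \<open>G\<close> are minimal, a homotopy changes them only by matrices without constant terms, so one
  minimal lift suffices.  The minimal generators of \<open>A\<close> are combinations of the monomials of degree
  \<open>a\<close> in the \<open>x_i^q\<close>, hence \<open>Z \<subseteq> (x_1^q, \<dots>, x_l^q) F_1\<close>.  On the other hand
  \<open>\<Sum>_{j<k} a_j p_j < q\<close> gives \<open>x_i^{q-1} \<in> B\<close> and so \<open>(x_1^{q-1}, \<dots>, x_l^{q-1}) F_1 \<subseteq> U\<close>.  The inclusion
  of \<open>Z\<close> into \<open>U\<close> thus factors through the inclusion of these two ideals, and the map of Koszul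
  complexes over the latter, \<open>e_T \<mapsto> (\<Prod>_{i \<in> T} x_i) e_T\<close>, is minimal.
\<close>

section \<open>Polynomials, ideals and Frobenius powers\<close>

text \<open>A degree-0 map may carry a constant wherever a shift of F meets one of G, and
  \<open>lam\<close> is known only through its relations. So one lift is built by hand, as a
  composite F -> K(x^q) (x) F_1 -> K(x^(q-1)) (x) F_1 -> G of Koszul complexes. The first arrow
  needs an exact target, so exactness is proved for the q-th powers only, by an explicit
  contraction; the last arrow uses exactness of G and that its source is a complex of free modules.
  The middle arrow is a chain map because x_i * x_i^(q-1) = x_i^q, and its coefficient at a nonempty
  T has positive degree.

  Minimality is always read off the coefficient \<open>lkp f 0\<close>. It respects sums and
  products and detects constants among homogeneous entries, so the lifts and homotopies can be
  chosen without tracking degrees.\<close>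

abbreviation lkp :: "('a \<Rightarrow>\<^sub>0 'b::zero) \<Rightarrow> 'a \<Rightarrow> 'b" where
  "lkp \<equiv> Poly_Mapping.lookup"

abbreviation kys :: "('a \<Rightarrow>\<^sub>0 'b::zero) \<Rightarrow> 'a set" where
  "kys \<equiv> Poly_Mapping.keys"

abbreviation sngl :: "'a \<Rightarrow> 'b \<Rightarrow> ('a \<Rightarrow>\<^sub>0 'b::zero)" where
  "sngl \<equiv> Poly_Mapping.single"

section \<open>Coefficients of products\<close>

lemma poly_mapping_sum_single: "(\<Sum>m\<in>kys f. sngl m (lkp f m)) = f"
proof (rule poly_mapping_eqI)
  fix k
  have "lkp (\<Sum>m\<in>kys f. sngl m (lkp f m)) k = (\<Sum>m\<in>kys f. if m = k then lkp f m else 0)"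
    by (simp add: lookup_sum lookup_single when_def)
  also have "\<dots> = lkp f k"
    by (simp add: in_keys_iff)
  finally show "lkp (\<Sum>m\<in>kys f. sngl m (lkp f m)) k = lkp f k" .
qed

lemma lookup_mult_sum:
  fixes f g :: "'a::comm_monoid_add \<Rightarrow>\<^sub>0 'b::comm_semiring_0"
  shows "lkp (f * g) k =
    (\<Sum>a\<in>kys f. \<Sum>b\<in>kys g. if a + b = k then lkp f a * lkp g b else 0)"
proof -
  have "f * g = (\<Sum>a\<in>kys f. \<Sum>b\<in>kys g. sngl (a + b) (lkp f a * lkp g b))"
    by (subst poly_mapping_sum_single[of f, symmetric],
        subst poly_mapping_sum_single[of g, symmetric],
        simp only: sum_product mult_single)
  then show ?thesis
    by (simp add: lookup_sum lookup_single when_def)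
qed

text \<open>When a single pair of exponents can sum to \<open>u + v\<close>, the convolution has one
  term and nothing cancels. \<open>u\<close> and \<open>v\<close> need not be keys: a missing one
  makes both sides zero.\<close>

lemma lookup_mult_unique:
  fixes f g :: "'a::comm_monoid_add \<Rightarrow>\<^sub>0 'b::comm_semiring_0"
  assumes "\<And>a b. a \<in> kys f \<Longrightarrow> b \<in> kys g \<Longrightarrow> a + b = u + v \<Longrightarrow> a = u \<and> b = v"
  shows "lkp (f * g) (u + v) = lkp f u * lkp g v"
proof -
  have "lkp (f * g) (u + v) =
      (\<Sum>a\<in>kys f. \<Sum>b\<in>kys g. if a = u then (if b = v then lkp f a * lkp g b else 0) else 0)"
    unfolding lookup_mult_sum using assms by (intro sum.cong refl) auto
  also have "\<dots> = (\<Sum>a\<in>kys f. if a = u then (\<Sum>b\<in>kys g. if b = v then lkp f a * lkp g b else 0) else 0)"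
    by (intro sum.cong refl) auto
  also have "\<dots> = lkp f u * lkp g v"
    by (simp add: in_keys_iff)
  finally show ?thesis .
qed

lemma expo_add_eq_0_iff: "a + b = 0 \<longleftrightarrow> a = 0 \<and> b = (0 :: 'a \<Rightarrow>\<^sub>0 nat)"
  by (metis add_is_0 add_0 lookup_add lookup_zero poly_mapping_eqI)

text \<open>Natural exponents sum to 0 only if both are 0. Hence one factor without constant term
  kills the constant term of a product, which is how minimality is used throughout.\<close>

lemma lookup_mult_0: "lkp (f * g) 0 = lkp f 0 * lkp g (0 :: 'a \<Rightarrow>\<^sub>0 nat)"
  for f :: "('a \<Rightarrow>\<^sub>0 nat) \<Rightarrow>\<^sub>0 'b::comm_semiring_0"
  using lookup_mult_unique[of f g 0 0] by (simp add: expo_add_eq_0_iff)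

lemma lookup_mult_const:
  fixes f :: "('a \<Rightarrow>\<^sub>0 nat) \<Rightarrow>\<^sub>0 'b::comm_semiring_0"
  shows "lkp (f * sngl 0 c) m = lkp f m * c"
proof -
  have "a = m \<and> b = 0" if "b \<in> kys (sngl 0 c)" "a + b = m + 0" for a b :: "'a \<Rightarrow>\<^sub>0 nat"
    using that by (simp split: if_splits)
  note * = lookup_mult_unique[of f "sngl 0 c" m 0, OF this]
  show ?thesis using * by simp
qed

lemma lookup_mult_single:
  fixes f :: "('a \<Rightarrow>\<^sub>0 nat) \<Rightarrow>\<^sub>0 'b::comm_semiring_1"
  shows "lkp (sngl t 1 * f) (t + m) = lkp f m"
  by (subst lookup_mult_unique) (auto split: if_splits)

lemma lookup_mult_single_0:
  fixes f :: "('a \<Rightarrow>\<^sub>0 nat) \<Rightarrow>\<^sub>0 'b::comm_semiring_1"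
  assumes "\<And>m'. m \<noteq> t + m'"
  shows "lkp (sngl t 1 * f) m = 0"
proof (rule ccontr)
  assume "lkp (sngl t 1 * f) m \<noteq> 0"
  then have "m \<in> kys (sngl t 1 * f)"
    by (simp add: in_keys_iff)
  then show False
    using keys_mult[of "sngl t 1" f] assms by (auto split: if_splits)
qed

lemma expo_split:
  assumes "t \<le> lkp m i"
  obtains m' :: "'a \<Rightarrow>\<^sub>0 nat" where "m = sngl i t + m'"
proof
  show "m = sngl i t + (m - sngl i t)"
    using assms by (intro poly_mapping_eqI) (auto simp: lookup_add lookup_minus lookup_single when_def)
qed

lemma expo_keys_add: "kys (a + b) = kys a \<union> kys (b :: 'a \<Rightarrow>\<^sub>0 nat)"
  by (auto simp: in_keys_iff lookup_add)

lemma mdeg_superset: "finite X \<Longrightarrow> kys m \<subseteq> X \<Longrightarrow> mdeg m = sum (lkp m) X"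
  unfolding mdeg_def by (rule sum.mono_neutral_left) (auto simp: in_keys_iff)

lemma mdeg_add: "mdeg (a + b) = mdeg a + mdeg b"
  using mdeg_superset[of "kys a \<union> kys b" a] mdeg_superset[of "kys a \<union> kys b" b]
    mdeg_superset[of "kys a \<union> kys b" "a + b"]
  by (simp add: expo_keys_add lookup_add sum.distrib)

lemma mdeg_single: "mdeg (sngl i t) = t"
  by (simp add: mdeg_def)

lemma mdeg_eq_0_iff: "mdeg m = 0 \<longleftrightarrow> m = 0"
  by (auto simp: mdeg_def in_keys_iff intro: poly_mapping_eqI)

lemma var_power: "var i ^ t = sngl (sngl i t) 1"
  by (induction t) (simp_all add: var_def mult_single single_add[symmetric])

lemma lookup_var_0 [simp]: "lkp (var i) 0 = 0"
proof -
  have "mdeg (sngl i 1) \<noteq> mdeg 0"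
    by (simp only: mdeg_single) (simp add: mdeg_def)
  then have "sngl i 1 \<noteq> (0 :: nat \<Rightarrow>\<^sub>0 nat)"
    by metis
  then show ?thesis
    unfolding var_def by (rule lookup_single_not_eq)
qed

section \<open>The ring R and homogeneous polynomials\<close>

lemma polys_zero [simp]: "0 \<in> polys n" by (simp add: polys_def)

lemma polys_one [simp]: "1 \<in> polys n" by (simp add: polys_def)

lemma polys_add [simp]: "f \<in> polys n \<Longrightarrow> g \<in> polys n \<Longrightarrow> f + g \<in> polys n"
  using keys_add[of f g] by (auto simp: polys_def)

lemma polys_uminus [simp]: "- f \<in> polys n \<longleftrightarrow> f \<in> polys n"
  by (simp add: polys_def in_keys_iff)

lemma polys_diff [simp]: "f \<in> polys n \<Longrightarrow> g \<in> polys n \<Longrightarrow> f - g \<in> polys n"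
  using polys_add[of f n "- g"] by simp

lemma polys_mult [simp]: "f \<in> polys n \<Longrightarrow> g \<in> polys n \<Longrightarrow> f * g \<in> polys n"
  using keys_mult[of f g] by (fastforce simp: polys_def expo_keys_add)

lemma polys_power [simp]: "f \<in> polys n \<Longrightarrow> f ^ t \<in> polys n"
  by (induction t) auto

lemma polys_sum [simp]: "(\<And>i. i \<in> X \<Longrightarrow> f i \<in> polys n) \<Longrightarrow> sum f X \<in> polys n"
  by (induction X rule: infinite_finite_induct) auto

lemma polys_prod [simp]: "(\<And>i. i \<in> X \<Longrightarrow> f i \<in> polys n) \<Longrightarrow> prod f X \<in> polys n"
  by (induction X rule: infinite_finite_induct) auto

lemma polys_single: "sngl m c \<in> polys n \<longleftrightarrow> c = 0 \<or> (\<forall>i\<in>kys m. i < n)"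
  by (simp add: polys_def)

lemma polys_var [simp]: "i < n \<Longrightarrow> var i \<in> polys n"
  by (simp add: var_def polys_single)

lemma homog_zero [simp]: "homog 0 d"
  by (simp add: homog_def)

lemma homog_add: "homog f d \<Longrightarrow> homog g d \<Longrightarrow> homog (f + g) d"
  using keys_add[of f g] by (auto simp: homog_def)

lemma homog_uminus [simp]: "homog (- f) d \<longleftrightarrow> homog f d"
  by (simp add: homog_def in_keys_iff)

lemma homog_mult:
  assumes "homog f d" "homog g e"
  shows "homog (f * g) (d + e)"
  unfolding homog_def
proof
  fix m assume "m \<in> kys (f * g)"
  then obtain a b where "m = a + b" "a \<in> kys f" "b \<in> kys g"
    using keys_mult[of f g] by blast
  then show "int (mdeg m) = d + e"
    using assms by (simp add: homog_def mdeg_add)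
qed

lemma homog_sum: "(\<And>i. i \<in> X \<Longrightarrow> homog (f i) d) \<Longrightarrow> homog (sum f X) d"
  by (induction X rule: infinite_finite_induct) (auto intro: homog_add)

text \<open>A nonzero constant term of a homogeneous polynomial forces degree 0, and then there is
  no other term.\<close>

lemma nonzero_const_homog_iff:
  assumes "homog f d"
  shows "nonzero_const f \<longleftrightarrow> lkp f 0 \<noteq> 0"
proof
  assume "nonzero_const f"
  then have "kys f = {0}"
    using keys_eq_empty[of f] unfolding nonzero_const_def by blast
  then have "0 \<in> kys f" by simp
  then show "lkp f 0 \<noteq> 0" unfolding in_keys_iff .
next
  assume "lkp f 0 \<noteq> 0"
  then have 0: "0 \<in> kys f" unfolding in_keys_iff .
  then have "int (mdeg 0) = d"
    using assms unfolding homog_def by blast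
  then have "d = 0" by (simp add: mdeg_def)
  then have "kys f \<subseteq> {0}"
    using assms by (auto simp: homog_def mdeg_eq_0_iff)
  moreover have "f \<noteq> 0" using 0 by auto
  ultimately show "nonzero_const f" by (simp only: nonzero_const_def) blast
qed

section \<open>Ideals, their products and powers\<close>

lemma ideal_gen_base:
  assumes "f \<in> S" shows "f \<in> ideal_gen n S"
  using ideal_gen.step[OF assms polys_one ideal_gen.zero] by simp

lemma ideal_gen_add:
  assumes "f \<in> ideal_gen n S" "g \<in> ideal_gen n S"
  shows "f + g \<in> ideal_gen n S"
  using assms by (induction rule: ideal_gen.induct) (auto simp: add.assoc intro: ideal_gen.step)

lemma ideal_gen_mult:
  assumes "f \<in> ideal_gen n S" "r \<in> polys n"
  shows "r * f \<in> ideal_gen n S"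
  using assms(1)
proof (induction rule: ideal_gen.induct)
  case zero
  then show ?case by (simp add: ideal_gen.zero)
next
  case (step s t q)
  then show ?case
    using ideal_gen.step[of s S "r * t" n "r * q"] assms(2) by (simp add: algebra_simps)
qed

lemma ideal_gen_polys: "S \<subseteq> polys n \<Longrightarrow> ideal_gen n S \<subseteq> polys n"
proof
  fix f assume S: "S \<subseteq> polys n" and "f \<in> ideal_gen n S"
  from this(2) show "f \<in> polys n"
    by induction (use S in \<open>auto intro!: polys_add polys_mult\<close>)
qed

lemma ideal_gen_least:
  fixes W :: "('k::field) mpoly set"
  assumes "0 \<in> W" "\<And>f g. f \<in> W \<Longrightarrow> g \<in> W \<Longrightarrow> f + g \<in> W"
    and "\<And>r f. r \<in> polys n \<Longrightarrow> f \<in> S \<Longrightarrow> r * f \<in> W"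
  shows "ideal_gen n S \<subseteq> W"
proof
  fix f assume "f \<in> ideal_gen n S"
  then show "f \<in> W"
  proof induction
    case zero
    show ?case by (rule assms(1))
  next
    case (step f r g)
    show ?case using assms(2)[OF assms(3)[OF step(2,1)] step(4)] .
  qed
qed

definition is_ideal :: "nat \<Rightarrow> ('k::field) mpoly set \<Rightarrow> bool" where
  "is_ideal n I \<longleftrightarrow> I \<subseteq> polys n \<and> 0 \<in> I \<and> (\<forall>f\<in>I. \<forall>g\<in>I. f + g \<in> I) \<and>
    (\<forall>r\<in>polys n. \<forall>f\<in>I. r * f \<in> I)"

lemma is_ideal_uminus:
  assumes "is_ideal n I" "f \<in> I"
  shows "- f \<in> I"
proof -
  have "(- 1) * f \<in> I"
    using assms polys_uminus[of 1 n] polys_one unfolding is_ideal_def by blast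
  then show ?thesis by simp
qed

lemma is_ideal_gen: "S \<subseteq> polys n \<Longrightarrow> is_ideal n (ideal_gen n S)"
  using ideal_gen_polys[of S n]
  by (auto simp: is_ideal_def intro: ideal_gen.zero ideal_gen_add ideal_gen_mult)

lemma is_ideal_polys: "is_ideal n (polys n)"
  by (auto simp: is_ideal_def)

lemma is_ideal_mult:
  assumes "A \<subseteq> polys n" "B \<subseteq> polys n"
  shows "is_ideal n (ideal_mult n A B)"
  unfolding ideal_mult_def using assms by (intro is_ideal_gen) (auto intro!: polys_mult)

lemma is_ideal_pow: "A \<subseteq> polys n \<Longrightarrow> is_ideal n (ideal_pow n A a)"
proof (induction a)
  case 0
  then show ?case by (simp add: is_ideal_polys)
next
  case (Suc a)
  then show ?case by (simp add: is_ideal_mult is_ideal_def[of n "ideal_pow n A a"])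
qed

lemma frob_gens_polys: "l \<le> n \<Longrightarrow> ideal_gen n {var i ^ p | i. i < l} \<subseteq> polys n"
  by (rule ideal_gen_polys) auto

lemma is_ideal_frob: "l \<le> n \<Longrightarrow> is_ideal n (frob_ideal n l p a)"
  unfolding frob_ideal_def by (intro is_ideal_pow frob_gens_polys)

lemma ideal_mult_mem: "f \<in> A \<Longrightarrow> g \<in> B \<Longrightarrow> f * g \<in> ideal_mult n A B"
  unfolding ideal_mult_def by (rule ideal_gen_base) auto

lemma ideal_mult_subset_left:
  fixes A :: "('k::field) mpoly set"
  assumes "is_ideal n A" "B \<subseteq> polys n"
  shows "ideal_mult n A B \<subseteq> A"
  unfolding ideal_mult_def
proof (rule ideal_gen_least)
  fix r f :: "'k mpoly" assume "r \<in> polys n" "f \<in> {a * b |a b. a \<in> A \<and> b \<in> B}"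
  then obtain g h where "r \<in> polys n" "g \<in> A" "h \<in> B" "f = g * h"
    by auto
  moreover have "r * f = (r * h) * g"
    by (simp add: \<open>f = g * h\<close> mult_ac)
  moreover have "r * h \<in> polys n"
    using calculation assms(2) by auto
  ultimately show "r * f \<in> A"
    using assms(1) by (simp only: is_ideal_def)
qed (use assms in \<open>auto simp: is_ideal_def\<close>)

text \<open>For \<open>q > 0\<close>, the largest b such that the monomial lies in the b-th power of
  the ideal of the x_i^q with \<open>i < l\<close>: it counts the blocks x_i^q that can be split
  off.\<close>

definition wt :: "nat \<Rightarrow> nat \<Rightarrow> (nat \<Rightarrow>\<^sub>0 nat) \<Rightarrow> nat" where
  "wt l q m = (\<Sum>i<l. lkp m i div q)"

text \<open>Only an inequality, since two remainders below \<open>q\<close> may combine to a further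
  block.\<close>

lemma wt_add: "wt l q a + wt l q b \<le> wt l q (a + b)"
  unfolding wt_def lookup_add sum.distrib[symmetric]
  by (intro sum_mono) (subst div_add1_eq, simp)

lemma wt_single: "q > 0 \<Longrightarrow> i < l \<Longrightarrow> wt l q (sngl i q) = 1"
proof -
  assume "q > 0" "i < l"
  then have "wt l q (sngl i q) = (\<Sum>j<l. if i = j then 1 else 0)"
    unfolding wt_def by (intro sum.cong refl) (simp add: lookup_single when_def)
  with \<open>i < l\<close> show ?thesis by simp
qed

lemma wt_single_add:
  assumes "q > 0" "i < l"
  shows "wt l q (sngl i q + m) = Suc (wt l q m)"
proof -
  have "wt l q (sngl i q + m) = (\<Sum>j<l. (if j = i then 1 else 0) + lkp m j div q)"
    unfolding wt_def using assms
    by (intro sum.cong refl) (auto simp: lookup_add lookup_single when_def div_add_self1)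
  then show ?thesis
    using assms by (simp add: sum.distrib wt_def)
qed

lemma wt_le_mdeg: "q * wt l q m \<le> mdeg m"
proof -
  have "q * wt l q m \<le> (\<Sum>i<l. lkp m i)"
    unfolding wt_def sum_distrib_left by (intro sum_mono) simp
  also have "\<dots> \<le> (\<Sum>i\<in>kys m \<union> {..<l}. lkp m i)"
    by (intro sum_mono2) auto
  also have "\<dots> = mdeg m"
    by (rule mdeg_superset[symmetric]) auto
  finally show ?thesis .
qed

text \<open>The degree is \<open>q * wt l q m\<close> plus the remainders modulo \<open>q\<close>
  plus the exponents outside the first \<open>l\<close> variables; equality leaves nothing for the
  last two.\<close>

lemma wt_eq_mdeg:
  assumes "q * wt l q m = mdeg m"
  shows "kys m \<subseteq> {..<l}" "\<And>i. q dvd lkp m i"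
proof -
  have le: "q * wt l q m \<le> (\<Sum>i<l. lkp m i)"
    unfolding wt_def sum_distrib_left by (intro sum_mono) simp
  have "mdeg m = sum (lkp m) ({..<l} \<union> (kys m - {..<l}))"
    by (rule mdeg_superset) auto
  also have "\<dots> = (\<Sum>i<l. lkp m i) + (\<Sum>i\<in>kys m - {..<l}. lkp m i)"
    by (rule sum.union_disjoint) auto
  finally have split: "mdeg m = (\<Sum>i<l. lkp m i) + (\<Sum>i\<in>kys m - {..<l}. lkp m i)" .
  have 0: "(\<Sum>i\<in>kys m - {..<l}. lkp m i) = 0"
    using le split assms by linarith
  then show keys: "kys m \<subseteq> {..<l}"
    by (auto simp: in_keys_iff)
  have "(\<Sum>i<l. lkp m i) = (\<Sum>i<l. q * (lkp m i div q) + lkp m i mod q)"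
    by simp
  also have "\<dots> = q * wt l q m + (\<Sum>i<l. lkp m i mod q)"
    unfolding wt_def sum_distrib_left by (rule sum.distrib)
  finally have "(\<Sum>i<l. lkp m i mod q) = 0"
    using split 0 assms by linarith
  then have *: "\<forall>i<l. lkp m i mod q = 0"
    by simp
  show "q dvd lkp m i" for i
  proof (cases "i < l")
    case True
    then show ?thesis using * by auto
  next
    case False
    then have "i \<notin> kys m" using keys by auto
    then show ?thesis by (simp add: in_keys_iff)
  qed
qed

text \<open>If some variable has index at least \<open>l\<close> or an exponent not divisible by
  \<open>q\<close>, cancelling it once costs no block. Otherwise the degree bound gives more than
  \<open>a\<close> blocks, and one may be broken up. So above degree \<open>q * a\<close> no
  monomial is a minimal generator.\<close>

lemma wt_reduce:
  assumes "q > 0" "a \<le> wt l q m" "q * a < mdeg m"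
  obtains i m' where "m = sngl i 1 + m'" "a \<le> wt l q m'"
proof (cases "\<exists>i. lkp m i \<noteq> 0 \<and> (i < l \<longrightarrow> lkp m i mod q \<noteq> 0)")
  case True
  then obtain i where i: "lkp m i \<noteq> 0" "i < l \<Longrightarrow> lkp m i mod q \<noteq> 0"
    by auto
  then have "1 \<le> lkp m i" by simp
  then obtain m' where m': "m = sngl i 1 + m'"
    by (rule expo_split)
  have "lkp m' j div q = lkp m j div q" if "j < l" for j
  proof (cases "j = i")
    case True
    then have "Suc (lkp m' j) mod q \<noteq> 0"
      using i that by (simp add: m' lookup_add)
    then show ?thesis
      using True by (simp add: m' lookup_add div_Suc)
  qed (simp add: m' lookup_add lookup_single)
  then have "wt l q m' = wt l q m"
    by (simp add: wt_def)
  then show ?thesis using m' assms that by auto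
next
  case False
  then have keys: "kys m \<subseteq> {..<l}" and dvd: "\<And>i. i < l \<Longrightarrow> q dvd lkp m i"
    by (auto simp: in_keys_iff) (metis dvd_0_right mod_0_imp_dvd)
  have "mdeg m = (\<Sum>i<l. lkp m i)"
    by (rule mdeg_superset) (use keys in auto)
  also have "\<dots> = (\<Sum>i<l. q * (lkp m i div q))"
    by (intro sum.cong refl) (use dvd in simp)
  finally have eq: "mdeg m = q * wt l q m"
    unfolding wt_def sum_distrib_left .
  have gt: "a < wt l q m"
    using assms(3) unfolding eq by simp
  then have "(\<Sum>i<l. lkp m i div q) \<noteq> 0"
    by (simp only: wt_def)
  then obtain i where i: "i < l" "lkp m i div q \<noteq> 0"
    by (rule sum.not_neutral_contains_not_neutral) auto
  then have "lkp m i \<ge> q"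
    using div_less[of "lkp m i" q] by (cases "lkp m i < q") auto
  then obtain m'' where m'': "m = sngl i q + m''"
    by (rule expo_split)
  have "m = sngl i 1 + (sngl i (q - 1) + m'')"
    using assms(1) m'' by (simp add: add.assoc[symmetric] single_add[symmetric])
  moreover have "a \<le> wt l q (sngl i (q - 1) + m'')"
    using gt wt_single_add[OF assms(1) i(1), of m''] wt_add[of l q "sngl i (q - 1)" m'']
    unfolding m'' by linarith
  ultimately show ?thesis using that by blast
qed

text \<open>Superadditivity of \<open>wt\<close> makes the sets \<open>W a\<close> a multiplicative
  filtration; every polynomial lies in \<open>W 0\<close>, every generator x_i^q in
  \<open>W 1\<close>.\<close>

lemma frob_ideal_keys:
  fixes f :: "('k::field) mpoly"
  assumes "q > 0" "f \<in> frob_ideal n l q a" "m \<in> kys f"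
  shows "a \<le> wt l q m"
proof -
  define W where "W a = {f :: 'k mpoly. \<forall>m\<in>kys f. a \<le> wt l q m}" for a
  have W_add: "f + g \<in> W a" if "f \<in> W a" "g \<in> W a" for f g a
    using that keys_add[of f g] by (auto simp: W_def)
  have W_mult: "f * g \<in> W (a + b)" if "f \<in> W a" "g \<in> W b" for f g a b
  proof -
    have "a + b \<le> wt l q (u + v)" if "a \<le> wt l q u" "b \<le> wt l q v" for u v
      using that wt_add[of l q u v] by simp
    then show ?thesis
      using that keys_mult[of f g] by (fastforce simp: W_def)
  qed
  have W_0: "f \<in> W 0" for f
    by (simp add: W_def)
  have W_zero: "0 \<in> W a" for a
    by (simp add: W_def)
  have base: "ideal_gen n {var i ^ q | i. i < l} \<subseteq> W 1"
  proof (rule ideal_gen_least)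
    fix r f :: "'k mpoly" assume "f \<in> {var i ^ q | i. i < l}"
    then have "f \<in> W 1"
      using assms(1) by (auto simp: W_def var_power wt_single)
    then show "r * f \<in> W 1"
      using W_mult[OF W_0] by fastforce
  qed (auto intro: W_add W_zero)
  have "frob_ideal n l q a \<subseteq> W a"
    unfolding frob_ideal_def
  proof (induction a)
    case (Suc a)
    show ?case
      unfolding ideal_pow.simps ideal_mult_def
    proof (rule ideal_gen_least)
      fix r f :: "'k mpoly"
      assume "f \<in> {x * b |x b. x \<in> ideal_gen n {var i ^ q | i. i < l} \<and>
          b \<in> ideal_pow n (ideal_gen n {var i ^ q |i. i < l}) a}"
      then have "f \<in> W (1 + a)"
        using base Suc W_mult by blast
      then show "r * f \<in> W (Suc a)"
        using W_mult[OF W_0] by fastforce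
    qed (auto intro: W_add W_zero)
  qed (use W_0 in auto)
  then show ?thesis
    using assms by (auto simp: W_def)
qed

text \<open>The converse for monomials: one block x_i^q is split off for each factor of the
  power.\<close>

lemma frob_ideal_single:
  fixes c :: "'k::field"
  assumes "q > 0" "l \<le> n" "kys m \<subseteq> {..<n}" "a \<le> wt l q m"
  shows "sngl m c \<in> frob_ideal n l q a"
  using assms(3,4)
proof (induction a arbitrary: m)
  case 0
  then show ?case by (auto simp: frob_ideal_def polys_single)
next
  case (Suc a)
  then have "(\<Sum>i<l. lkp m i div q) \<noteq> 0"
    by (simp only: wt_def)
  then obtain i where i: "i < l" "lkp m i div q \<noteq> 0"
    by (rule sum.not_neutral_contains_not_neutral) auto
  then have "lkp m i \<ge> q"
    using div_less[of "lkp m i" q] by (cases "lkp m i < q") auto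
  then obtain m' where m': "m = sngl i q + m'"
    by (rule expo_split)
  then have "sngl m' c \<in> frob_ideal n l q a"
    using Suc wt_single_add[OF assms(1) i(1), of m'] by (auto simp: expo_keys_add)
  moreover have "sngl m c = var i ^ q * sngl m' c"
    by (simp add: var_power m' mult_single)
  moreover have "var i ^ q \<in> ideal_gen n {var i ^ q :: 'k mpoly | i. i < l}"
    using i by (auto intro: ideal_gen_base)
  ultimately show ?case
    unfolding frob_ideal_def by (simp add: ideal_mult_mem)
qed

section \<open>The Koszul complex of powers of variables\<close>

text \<open>Keeps the monomials of \<open>f\<close> in which x_i is the first variable with exponent
  at least \<open>q\<close>, divided by x_i^q. The test for \<open>j < i\<close> may be made on the
  quotient, since the division leaves these exponents unchanged.\<close>

definition lowdiv :: "nat \<Rightarrow> nat \<Rightarrow> ('k::field) mpoly \<Rightarrow> 'k mpoly" where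
  "lowdiv q i f =
     Abs_poly_mapping (\<lambda>m. if \<forall>j<i. lkp m j < q then lkp f (sngl i q + m) else 0)"

lemma lookup_lowdiv:
  "lkp (lowdiv q i f) m = (if \<forall>j<i. lkp m j < q then lkp f (sngl i q + m) else 0)"
proof -
  have "finite ((\<lambda>m. sngl i q + m) -` kys f)"
    by (intro finite_vimageI) (auto simp: inj_def)
  then have "finite {m. (if \<forall>j<i. lkp m j < q then lkp f (sngl i q + m) else 0) \<noteq> 0}"
    by (rule finite_subset[rotated]) (auto simp: in_keys_iff)
  then show ?thesis
    unfolding lowdiv_def by simp
qed

lemma lowdiv_polys [simp]:
  assumes "f \<in> polys n"
  shows "lowdiv q i f \<in> polys n"
  unfolding polys_def mem_Collect_eq
proof (intro ballI)
  fix m j assume "m \<in> kys (lowdiv q i f)" and j: "j \<in> kys m"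
  then have "sngl i q + m \<in> kys f"
    by (auto simp: in_keys_iff lookup_lowdiv split: if_splits)
  then have "\<forall>j\<in>kys (sngl i q + m). j < n"
    using assms unfolding polys_def by blast
  then show "j < n"
    using j by (simp add: expo_keys_add del: keys_single)
qed

lemma lowdiv_zero [simp]: "lowdiv q i 0 = 0"
  by (rule poly_mapping_eqI) (simp add: lookup_lowdiv)

lemma lowdiv_add: "lowdiv q i (f + g) = lowdiv q i f + lowdiv q i g"
  by (rule poly_mapping_eqI) (auto simp: lookup_lowdiv lookup_add)

lemma lowdiv_uminus: "lowdiv q i (- f) = - lowdiv q i f"
  by (rule poly_mapping_eqI) (auto simp: lookup_lowdiv)

lemma lowdiv_sum: "lowdiv q i (sum f X) = (\<Sum>x\<in>X. lowdiv q i (f x))"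
  by (induction X rule: infinite_finite_induct) (simp_all add: lowdiv_add)

text \<open>Multiplying by x_i^q first turns \<open>lowdiv\<close> into the projection onto
  monomials with exponents below \<open>q\<close> in all variables before x_i. Remainders are
  written this way below.\<close>

lemma lookup_lowdiv_mult_same:
  "lkp (lowdiv q i (var i ^ q * f)) m = (if \<forall>j<i. lkp m j < q then lkp f m else 0)"
  by (auto simp: lookup_lowdiv var_power lookup_mult_single)

lemma lookup_mult_lowdiv:
  "lkp (var i ^ q * lowdiv q i f) m =
     (if q \<le> lkp m i \<and> (\<forall>j<i. lkp m j < q) then lkp f m else 0)"
proof (cases "q \<le> lkp m i")
  case True
  then obtain m' where "m = sngl i q + m'"
    by (rule expo_split)
  then show ?thesis
    by (auto simp: var_power lookup_mult_single lookup_lowdiv lookup_add lookup_single)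
next
  case False
  have "lkp (sngl (sngl i q) 1 * lowdiv q i f) m = 0"
    by (rule lookup_mult_single_0) (use False in \<open>auto simp: lookup_add\<close>)
  then show ?thesis
    using False by (simp add: var_power)
qed

text \<open>A factor x_j^q with \<open>j > i\<close> affects neither the exponents tested nor the
  division by x_i^q.\<close>

lemma lowdiv_mult_greater:
  assumes "i < j"
  shows "lowdiv q i (var j ^ q * f) = var j ^ q * lowdiv q i f"
proof (rule poly_mapping_eqI)
  fix m
  show "lkp (lowdiv q i (var j ^ q * f)) m = lkp (var j ^ q * lowdiv q i f) m"
  proof (cases "q \<le> lkp m j")
    case True
    then obtain m' where m': "m = sngl j q + m'"
      by (rule expo_split)
    have "lkp (lowdiv q i (var j ^ q * f)) m =
        (if \<forall>t<i. lkp (sngl j q + m') t < q then lkp (sngl (sngl j q) 1 * f) (sngl j q + (sngl i q + m')) else 0)"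
      by (simp only: lookup_lowdiv var_power m' add.left_commute)
    also have "\<dots> = (if \<forall>t<i. lkp m' t < q then lkp f (sngl i q + m') else 0)"
    proof -
      have "lkp (sngl j q + m') t = lkp m' t" if "t < i" for t
        using that assms by (simp add: lookup_add lookup_single)
      then show ?thesis
        unfolding lookup_mult_single by (intro if_cong) auto
    qed
    finally show ?thesis
      by (simp add: var_power m' lookup_mult_single lookup_lowdiv)
  next
    case False
    have "lkp (sngl (sngl j q) 1 * lowdiv q i f) m = 0"
      by (rule lookup_mult_single_0) (use False in \<open>auto simp: lookup_add\<close>)
    moreover have "lkp (sngl (sngl j q) 1 * f) (sngl i q + m) = 0"
    proof (rule lookup_mult_single_0)
      fix m'
      have "lkp (sngl i q + m) j = lkp m j"
        using assms by (simp add: lookup_add lookup_single)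
      then show "sngl i q + m \<noteq> sngl j q + m'"
        using False by (metis le_add1 lookup_add lookup_single_eq)
    qed
    ultimately show ?thesis
      by (simp add: var_power lookup_lowdiv)
  qed
qed

text \<open>In a multiple of x_j^q the variable x_j already has exponent at least \<open>q\<close>,
  so x_i is never the first such variable.\<close>

lemma lowdiv_mult_less:
  assumes "j < i"
  shows "lowdiv q i (var j ^ q * f) = 0"
proof (rule poly_mapping_eqI)
  fix m
  have "lkp (sngl (sngl j q) 1 * f) (sngl i q + m) = 0" if "lkp m j < q"
  proof (rule lookup_mult_single_0)
    fix m'
    have "lkp (sngl i q + m) j = lkp m j"
      using assms by (simp add: lookup_add lookup_single)
    then show "sngl i q + m \<noteq> sngl j q + m'"
      using that by (metis le_add1 lookup_add lookup_single_eq not_le)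
  qed
  then show "lkp (lowdiv q i (var j ^ q * f)) m = lkp 0 m"
    using assms by (simp add: lookup_lowdiv var_power)
qed

text \<open>Monomials are sorted by their first variable of exponent at least \<open>q\<close>; the
  last summand collects those with no such variable before x_i.\<close>

lemma lowdiv_partition:
  "(\<Sum>j<i. var j ^ q * lowdiv q j f) + lowdiv q i (var i ^ q * f) = f"
proof (induction i)
  case 0
  show ?case
    by (rule poly_mapping_eqI) (simp add: lookup_lowdiv_mult_same del: mult_eq_0_iff)
next
  case (Suc i)
  have "var i ^ q * lowdiv q i f + lowdiv q (Suc i) (var (Suc i) ^ q * f) = lowdiv q i (var i ^ q * f)"
  proof (rule poly_mapping_eqI)
    fix m
    show "lkp (var i ^ q * lowdiv q i f + lowdiv q (Suc i) (var (Suc i) ^ q * f)) m =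
        lkp (lowdiv q i (var i ^ q * f)) m"
      unfolding lookup_add lookup_mult_lowdiv lookup_lowdiv_mult_same
      by (auto simp: less_Suc_eq)
  qed
  then show ?case
    using Suc by (simp add: add.assoc)
qed

text \<open>The sign of moving e_i to its place in the increasing wedge product over
  \<open>T\<close>. Counting only \<open>j < i\<close> gives the same value whether or not
  \<open>i\<close> is in \<open>T\<close>, so it serves for inserting and for removing.\<close>

definition ksgn :: "nat \<Rightarrow> nat set \<Rightarrow> ('k::field) mpoly" where
  "ksgn i T = (- 1) ^ card {j\<in>T. j < i}"

lemma ksgn_cases: "ksgn i T = (1 :: ('k::field) mpoly) \<or> ksgn i T = (- 1 :: 'k mpoly)"
  by (cases "even (card {j\<in>T. j < i})") (simp_all add: ksgn_def)

lemma ksgn_polys [simp]: "(ksgn i T :: ('k::field) mpoly) \<in> polys n"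
proof -
  have "ksgn i T = (1 :: 'k mpoly) \<or> ksgn i T = (- 1 :: 'k mpoly)"
    by (rule ksgn_cases)
  then show ?thesis by auto
qed

lemma ksgn_below: "(\<And>j. j \<in> T \<Longrightarrow> i \<le> j) \<Longrightarrow> ksgn i T = 1"
proof -
  assume "\<And>j. j \<in> T \<Longrightarrow> i \<le> j"
  then have "{j\<in>T. j < i} = {}" by fastforce
  then show ?thesis by (simp only: ksgn_def card.empty power_0)
qed

lemma ksgn_insert_ge: "j \<le> i \<Longrightarrow> ksgn j (insert i T) = ksgn j T"
proof -
  assume "j \<le> i"
  then have "{t \<in> insert i T. t < j} = {t\<in>T. t < j}" by auto
  then show ?thesis by (simp add: ksgn_def)
qed

lemma ksgn_insert_less:
  assumes "i < j" "i \<notin> T" "finite T"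
  shows "ksgn j (insert i T) = - ksgn j T"
proof -
  have "{t \<in> insert i T. t < j} = insert i {t\<in>T. t < j}" using assms by auto
  then show ?thesis using assms by (simp add: ksgn_def)
qed

lemma lowdiv_ksgn: "lowdiv q i (ksgn j T * f) = ksgn j T * lowdiv q i f"
  for f :: "('k::field) mpoly"
proof -
  have "ksgn j T = (1 :: 'k mpoly) \<or> ksgn j T = (- 1 :: 'k mpoly)"
    by (rule ksgn_cases)
  then show ?thesis by (auto simp: lowdiv_uminus)
qed

text \<open>Exactness of the Koszul complex of \<open>x_0^q, \<dots>, x_{l-1}^q\<close>: dividing by the power of the
  least possible variable is a contracting homotopy.\<close>

lemma koszul_contraction:
  fixes c :: "nat set \<Rightarrow> ('k::field) mpoly"
  assumes T: "T \<noteq> {}" "T \<subseteq> {..<l}"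
    and cycle: "(\<Sum>j\<in>{..<l} - (T - {Min T}).
        ksgn j (T - {Min T}) * var j ^ q * c (insert j (T - {Min T}))) = 0"
  shows "(\<Sum>j\<in>{..<l} - T. ksgn j T * var j ^ q *
      lowdiv q (Min (insert j T)) (c (insert j T - {Min (insert j T)}))) = c T"
proof -
  define i where "i = Min T"
  define U where "U = T - {i}"
  \<comment> \<open>\<open>E j\<close> is \<open>lowdiv q i\<close> of the term \<open>j\<close> in
    the cycle condition at \<open>U\<close>. As \<open>insert i U = T\<close>, the term
    \<open>E i\<close> is the remainder of \<open>c T\<close>, and the vanishing of the sum trades
    it for the other terms.\<close>
  define E where "E j = ksgn j U * lowdiv q i (var j ^ q * c (insert j U))" for j
  have fin: "finite T"
    using T(2) finite_subset by blast
  have "i \<in> T"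
    using Min_in[OF fin T(1)] by (simp add: i_def)
  moreover from this have "i < l"
    using T by blast
  ultimately have i: "i \<in> T" "\<And>j. j \<in> T \<Longrightarrow> i \<le> j" "i < l" "i \<notin> U"
    using fin by (auto simp: i_def U_def)
  have TU: "T = insert i U" "finite U"
    using i fin by (auto simp: U_def)
  have "(\<Sum>j\<in>{..<l} - U. E j) = lowdiv q i (\<Sum>j\<in>{..<l} - U. ksgn j U * (var j ^ q * c (insert j U)))"
    by (simp add: E_def lowdiv_sum lowdiv_ksgn)
  also have "\<dots> = 0"
    using cycle by (simp only: i_def[symmetric] U_def[symmetric] mult.assoc lowdiv_zero)
  finally have sum0: "(\<Sum>j\<in>{..<l} - U. E j) = 0" .
  have "{..<l} - U = insert i ({..<l} - T)"
    using i TU by auto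
  then have "E i + (\<Sum>j\<in>{..<l} - T. E j) = 0"
    using sum0 i by simp
  moreover have "ksgn i U = (1 :: 'k mpoly)"
    using i by (intro ksgn_below) (auto simp: TU)
  ultimately have sumE: "(\<Sum>j\<in>{..<l} - T. E j) = - lowdiv q i (var i ^ q * c T)"
    by (simp add: E_def TU(1)[symmetric] add_eq_0_iff)
  have "(\<Sum>j\<in>{..<l} - T. ksgn j T * var j ^ q *
      lowdiv q (Min (insert j T)) (c (insert j T - {Min (insert j T)}))) =
    (\<Sum>j\<in>{..<l} - T. (if j \<in> {..<i} then var j ^ q * lowdiv q j (c T) else 0) - E j)"
  proof (rule sum.cong[OF refl])
    fix j assume j: "j \<in> {..<l} - T"
    have fin': "finite (insert j T)" using fin by simp
    show "ksgn j T * var j ^ q * lowdiv q (Min (insert j T)) (c (insert j T - {Min (insert j T)}))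
        = (if j \<in> {..<i} then var j ^ q * lowdiv q j (c T) else 0) - E j"
    \<comment> \<open>For \<open>j < i\<close> the new minimum is \<open>j\<close>, and dropping it
      returns \<open>T\<close>. For \<open>j > i\<close> the minimum stays \<open>i\<close>, and the
      extra sign in \<open>ksgn j T\<close> yields \<open>- E j\<close>.\<close>
    proof (cases "j < i")
      case True
      have "Min (insert j T) = j"
        using True i fin T by (intro Min_eqI) force+
      moreover have "insert j T - {j} = T"
        using j by auto
      moreover have "ksgn j T = (1 :: 'k mpoly)"
        using i True by (intro ksgn_below) force
      moreover have "E j = 0"
        using True by (simp add: E_def lowdiv_mult_less)
      ultimately show ?thesis using True by simp
    next
      case False
      then have ij: "i < j"
        using j i by (metis DiffD2 linorder_neqE_nat)
      have "Min (insert j T) = i"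
        using ij i fin T by (intro Min_eqI) force+
      moreover have "insert j T - {i} = insert j U"
        using ij TU i by auto
      moreover have "ksgn j T = - (ksgn j U :: 'k mpoly)"
        unfolding TU(1) using ij i TU by (intro ksgn_insert_less)
      moreover have "lowdiv q i (var j ^ q * c (insert j U)) = var j ^ q * lowdiv q i (c (insert j U))"
        using ij by (rule lowdiv_mult_greater)
      ultimately show ?thesis using False by (simp add: E_def mult.assoc)
    qed
  qed
  also have "\<dots> = (\<Sum>j\<in>{..<l} - T. if j \<in> {..<i} then var j ^ q * lowdiv q j (c T) else 0) -
      (\<Sum>j\<in>{..<l} - T. E j)"
    by (rule sum_subtractf)
  also have "(\<Sum>j\<in>{..<l} - T. if j \<in> {..<i} then var j ^ q * lowdiv q j (c T) else 0) =
      (\<Sum>j\<in>({..<l} - T) \<inter> {..<i}. var j ^ q * lowdiv q j (c T))"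
    by (rule sum.inter_restrict[symmetric]) simp
  also have "({..<l} - T) \<inter> {..<i} = {..<i}"
    using i by fastforce
  finally show ?thesis
    using lowdiv_partition[of q "c T" i] by (simp only: sumE diff_minus_eq_add)
qed

text \<open>At the end of the Koszul complex the cycle condition is replaced by membership in the
  ideal, which for a monomial ideal is a condition on each exponent.\<close>

lemma koszul_contraction_0:
  assumes "\<And>m. m \<in> kys f \<Longrightarrow> \<exists>j<l. q \<le> lkp m j"
  shows "(\<Sum>j<l. var j ^ q * lowdiv q j f) = f"
proof -
  \<comment> \<open>\<open>var l\<close> is outside the range; the product merely expresses the
    projection onto monomials whose first \<open>l\<close> exponents are below
    \<open>q\<close>.\<close>
  have "lowdiv q l (var l ^ q * f) = 0"
  proof (rule poly_mapping_eqI)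
    fix m
    have "lkp f m = 0" if "\<forall>j<l. lkp m j < q"
      using assms[of m] that by (meson in_keys_iff not_le)
    then show "lkp (lowdiv q l (var l ^ q * f)) m = lkp 0 m"
      by (simp add: lookup_lowdiv_mult_same)
  qed
  then show ?thesis
    using lowdiv_partition[of q f l] by simp
qed

text \<open>The pairs (i, j) and (j, i) cancel. That the sum equals its own negative would prove
  nothing in characteristic two, so one triangle is swapped onto the other.\<close>

lemma sum_antisym:
  fixes F :: "nat \<Rightarrow> nat \<Rightarrow> 'a::ab_group_add"
  assumes "finite T" "\<And>i j. i \<in> T \<Longrightarrow> j \<in> T \<Longrightarrow> i < j \<Longrightarrow> F j i = - F i j"
  shows "(\<Sum>i\<in>T. \<Sum>j\<in>T - {i}. F i j) = 0"
proof -
  have "(\<Sum>i\<in>T. \<Sum>j\<in>T - {i}. F i j) =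
      (\<Sum>i\<in>T. \<Sum>j\<in>T. (if i < j then F i j else 0) + (if j < i then F i j else 0))"
  proof (rule sum.cong[OF refl])
    fix i assume "i \<in> T"
    show "(\<Sum>j\<in>T - {i}. F i j) = (\<Sum>j\<in>T. (if i < j then F i j else 0) + (if j < i then F i j else 0))"
      by (rule sum.mono_neutral_cong_left) (use assms(1) in auto)
  qed
  also have "\<dots> = (\<Sum>i\<in>T. \<Sum>j\<in>T. if i < j then F i j else 0) + (\<Sum>i\<in>T. \<Sum>j\<in>T. if j < i then F i j else 0)"
    by (simp add: sum.distrib)
  also have "(\<Sum>i\<in>T. \<Sum>j\<in>T. if j < i then F i j else 0) = (\<Sum>j\<in>T. \<Sum>i\<in>T. if j < i then F i j else 0)"
    by (rule sum.swap)
  also have "\<dots> = (\<Sum>i\<in>T. \<Sum>j\<in>T. - (if i < j then F i j else 0))"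
    by (intro sum.cong refl) (use assms(2) in auto)
  also have "\<dots> = - (\<Sum>i\<in>T. \<Sum>j\<in>T. if i < j then F i j else 0)"
    by (simp add: sum_negf)
  finally show ?thesis by simp
qed

text \<open>For \<open>i < j\<close>, removing \<open>i\<close> first shifts \<open>j\<close> by one
  place and flips its sign, while removing \<open>j\<close> first leaves the sign of
  \<open>i\<close> alone.\<close>

lemma koszul_square_zero:
  fixes y :: "nat \<Rightarrow> ('k::field) mpoly" and b :: "nat set \<Rightarrow> 'k mpoly"
  assumes "finite T"
  shows "(\<Sum>i\<in>T. ksgn i T * y i * (\<Sum>j\<in>T - {i}. ksgn j (T - {i}) * y j * b (T - {i} - {j}))) = 0"
proof -
  have "(\<Sum>i\<in>T. \<Sum>j\<in>T - {i}.
      ksgn i T * y i * (ksgn j (T - {i}) * y j * b (T - {i} - {j}))) = 0"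
  proof (rule sum_antisym[OF assms])
    fix i j assume ij: "i \<in> T" "j \<in> T" "i < j"
    define U where "U = T - {i} - {j}"
    have U: "T - {i} = insert j U" "T - {j} = insert i U" "T - {j} - {i} = U" "T = insert i (insert j U)"
      "i \<notin> U" "j \<notin> U" "finite U"
      using ij assms by (auto simp: U_def)
    have "ksgn i (insert i (insert j U)) = (ksgn i U :: 'k mpoly)" "ksgn i (insert i U) = (ksgn i U :: 'k mpoly)"
      "ksgn j (insert i (insert j U)) = - (ksgn j U :: 'k mpoly)" "ksgn j (insert j U) = (ksgn j U :: 'k mpoly)"
      using ij U by (simp_all add: ksgn_insert_ge ksgn_insert_less)
    then show "ksgn j T * y j * (ksgn i (T - {j}) * y i * b (T - {j} - {i})) =
        - (ksgn i T * y i * (ksgn j (T - {i}) * y j * b (T - {i} - {j})))"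
      unfolding U(3) U_def[symmetric] unfolding U(1,2) unfolding U(4) by (simp add: mult_ac)
  qed
  then show ?thesis
    by (simp only: sum_distrib_left)
qed

section \<open>The reduced horseshoe complex is a resolution\<close>

lemma vecs_add: "v \<in> vecs n r \<Longrightarrow> w \<in> vecs n r \<Longrightarrow> (\<lambda>i. v i + w i) \<in> vecs n r"
  by (simp add: vecs_def)

lemma vecs_diff: "v \<in> vecs n r \<Longrightarrow> w \<in> vecs n r \<Longrightarrow> (\<lambda>i. v i - w i) \<in> vecs n r"
  by (simp add: vecs_def)

lemma vecs_uminus: "v \<in> vecs n r \<Longrightarrow> (\<lambda>i. - v i) \<in> vecs n r"
  by (simp add: vecs_def)

lemma vecs_mat_app:
  "(\<And>j i. j < m \<Longrightarrow> i < r \<Longrightarrow> M j i \<in> polys n) \<Longrightarrow> v \<in> vecs n r \<Longrightarrow> mat_app m r M v \<in> vecs n m"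
  by (auto simp: vecs_def mat_app_def intro!: polys_sum polys_mult)

lemma mat_app_add: "mat_app m r M (\<lambda>i. v i + w i) j = mat_app m r M v j + mat_app m r M w j"
  by (simp add: mat_app_def distrib_left sum.distrib)

lemma mat_app_diff: "mat_app m r M (\<lambda>i. v i - w i) j = mat_app m r M v j - mat_app m r M w j"
  by (simp add: mat_app_def right_diff_distrib sum_subtractf)

lemma mat_app_uminus: "mat_app m r M (\<lambda>i. - v i) j = - mat_app m r M v j"
  by (simp add: mat_app_def sum_negf)

lemma mat_app_mult: "mat_app m t M (mat_app t r N v) = mat_app m r (mat_mult t M N) v"
proof
  fix j
  have "(\<Sum>u<t. M j u * (\<Sum>i<r. N u i * v i)) = (\<Sum>i<r. (\<Sum>u<t. M j u * N u i) * v i)"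
    by (simp add: sum_distrib_left sum_distrib_right mult.assoc)
      (rule sum.swap)
  then show "mat_app m t M (mat_app t r N v) j = mat_app m r (mat_mult t M N) v j"
    by (simp add: mat_app_def mat_mult_def)
qed

lemma sum_lessThan_add:
  "(\<Sum>i<g + f. F i) = (\<Sum>i<g. F i) + (\<Sum>i<f. F (g + i :: nat) :: 'a::comm_monoid_add)"
  by (induction f) (simp_all add: add.assoc)

lemma kernI: "v \<in> vecs n r \<Longrightarrow> (\<And>j. mat_app m r M v j = 0) \<Longrightarrow> v \<in> kern n m r M"
  by (auto simp: kern_def)

lemma mem_ideal_vecs_iff:
  "v \<in> ideal_vecs n I \<longleftrightarrow> v 0 \<in> polys n \<inter> I \<and> (\<forall>i>0. v i = 0)"
  by (auto simp: ideal_vecs_def vecs_def)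

text \<open>Indices are shifted by \<open>Suc\<close> to avoid the truncated subtractions of
  \<open>horseshoe_maps\<close>. Degrees and minimality are absent because exactness is purely
  formal.\<close>

locale horseshoe =
  fixes n :: nat and fr gr :: "nat \<Rightarrow> nat" and d2 d1 lam :: "nat \<Rightarrow> ('k::field) mmat"
  assumes gr_0: "gr 0 = fr (Suc 0)"
    and d2_polys: "\<And>k j i. j < fr k \<Longrightarrow> i < fr (Suc k) \<Longrightarrow> d2 (Suc k) j i \<in> polys n"
    and d1_polys: "\<And>k j i. j < gr k \<Longrightarrow> i < gr (Suc k) \<Longrightarrow> d1 (Suc k) j i \<in> polys n"
    and lam_polys: "\<And>k j i. j < gr k \<Longrightarrow> i < fr (Suc k) \<Longrightarrow> lam (Suc k) j i \<in> polys n"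
    and d2_exact: "\<And>k. kern n (fr k) (fr (Suc k)) (d2 (Suc k)) =
      img n (fr (Suc k)) (fr (Suc (Suc k))) (d2 (Suc (Suc k)))"
    and d1_exact: "\<And>k. kern n (gr k) (gr (Suc k)) (d1 (Suc k)) =
      img n (gr (Suc k)) (gr (Suc (Suc k))) (d1 (Suc (Suc k)))"
    and lam_Suc_0: "\<And>j i. j < fr (Suc 0) \<Longrightarrow> i < fr (Suc 0) \<Longrightarrow>
      lam (Suc 0) j i = (if j = i then - 1 else 0)"
    and lam_chain: "\<And>k j i. j < gr k \<Longrightarrow> i < fr (Suc (Suc k)) \<Longrightarrow>
      mat_mult (gr (Suc k)) (d1 (Suc k)) (lam (Suc (Suc k))) j i =
      - mat_mult (fr (Suc k)) (lam (Suc k)) (d2 (Suc (Suc k))) j i"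
begin

definition dF :: "nat \<Rightarrow> 'k mvec \<Rightarrow> 'k mvec" where
  "dF k = mat_app (fr k) (fr (Suc k)) (d2 (Suc k))"

definition dG :: "nat \<Rightarrow> 'k mvec \<Rightarrow> 'k mvec" where
  "dG k = mat_app (gr k) (gr (Suc k)) (d1 (Suc k))"

definition L :: "nat \<Rightarrow> 'k mvec \<Rightarrow> 'k mvec" where
  "L k = mat_app (gr k) (fr (Suc k)) (lam (Suc k))"

lemma dF_vecs: "v \<in> vecs n (fr (Suc k)) \<Longrightarrow> dF k v \<in> vecs n (fr k)"
  unfolding dF_def by (rule vecs_mat_app) (auto intro: d2_polys)

lemma dG_vecs: "v \<in> vecs n (gr (Suc k)) \<Longrightarrow> dG k v \<in> vecs n (gr k)"
  unfolding dG_def by (rule vecs_mat_app) (auto intro: d1_polys)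

lemma L_vecs: "v \<in> vecs n (fr (Suc k)) \<Longrightarrow> L k v \<in> vecs n (gr k)"
  unfolding L_def by (rule vecs_mat_app) (auto intro: lam_polys)

lemma dF_dF: "v \<in> vecs n (fr (Suc (Suc k))) \<Longrightarrow> dF k (dF (Suc k) v) j = 0"
  using d2_exact[of k] by (auto simp: dF_def kern_def img_def fun_eq_iff)

lemma dG_dG: "v \<in> vecs n (gr (Suc (Suc k))) \<Longrightarrow> dG k (dG (Suc k) v) j = 0"
  using d1_exact[of k] by (auto simp: dG_def kern_def img_def fun_eq_iff)

lemma dF_exact:
  assumes "v \<in> vecs n (fr (Suc k))" "\<And>j. dF k v j = 0"
  obtains w where "w \<in> vecs n (fr (Suc (Suc k)))" "v = dF (Suc k) w"
  using kernI[of v n "fr (Suc k)" "fr k" "d2 (Suc k)"] assms d2_exact[of k]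
  by (auto simp: dF_def img_def)

lemma dG_exact:
  assumes "v \<in> vecs n (gr (Suc k))" "\<And>j. dG k v j = 0"
  obtains w where "w \<in> vecs n (gr (Suc (Suc k)))" "v = dG (Suc k) w"
  using kernI[of v n "gr (Suc k)" "gr k" "d1 (Suc k)"] assms d1_exact[of k]
  by (auto simp: dG_def img_def)

lemma dG_L: "dG k (L (Suc k) v) j = - L k (dF (Suc k) v) j"
proof -
  have "(\<Sum>i<fr (Suc (Suc k)). mat_mult (gr (Suc k)) (d1 (Suc k)) (lam (Suc (Suc k))) j i * v i) =
      (\<Sum>i<fr (Suc (Suc k)). - (mat_mult (fr (Suc k)) (lam (Suc k)) (d2 (Suc (Suc k))) j i * v i))"
    if "j < gr k"
    using that by (intro sum.cong refl) (simp add: lam_chain)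
  then show ?thesis
    unfolding dG_def L_def dF_def mat_app_mult by (simp add: mat_app_def sum_negf)
qed

lemma L_0:
  assumes "v \<in> vecs n (fr (Suc 0))"
  shows "L 0 v j = - v j"
proof (cases "j < fr (Suc 0)")
  case True
  have "(\<Sum>i<fr (Suc 0). lam (Suc 0) j i * v i) = (\<Sum>i<fr (Suc 0). if j = i then - v i else 0)"
    using True by (intro sum.cong refl) (simp add: lam_Suc_0)
  then show ?thesis
    using True by (simp add: L_def mat_app_def gr_0)
next
  case False
  then show ?thesis
    using assms by (simp add: L_def mat_app_def gr_0 vecs_def)
qed

text \<open>The sign of the chain relation cancels against lambda_1 = -id. This identity lets the
  cancelled pair F_1 = G_0 be bypassed in degrees 1 and 2.\<close>

lemma dG_L_0: "v \<in> vecs n (fr (Suc (Suc 0))) \<Longrightarrow> dG 0 (L (Suc 0) v) j = dF (Suc 0) v j"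
  using dG_L[of 0 v j] L_0[OF dF_vecs[of v "Suc 0"]] by simp

section \<open>Block vectors and the differentials of the reduced complex\<close>

definition fstv :: "nat \<Rightarrow> 'k mvec \<Rightarrow> 'k mvec" where
  "fstv g v = (\<lambda>i. if i < g then v i else 0)"

definition sndv :: "nat \<Rightarrow> 'k mvec \<Rightarrow> 'k mvec" where
  "sndv g v = (\<lambda>i. v (g + i))"

definition joinv :: "nat \<Rightarrow> 'k mvec \<Rightarrow> 'k mvec \<Rightarrow> 'k mvec" where
  "joinv g v w = (\<lambda>i. if i < g then v i else w (i - g))"

lemma fstv_vecs: "v \<in> vecs n (g + f) \<Longrightarrow> fstv g v \<in> vecs n g"
  by (simp add: vecs_def fstv_def)

lemma sndv_vecs: "v \<in> vecs n (g + f) \<Longrightarrow> sndv g v \<in> vecs n f"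
  by (simp add: vecs_def sndv_def)

lemma joinv_vecs: "v \<in> vecs n g \<Longrightarrow> w \<in> vecs n f \<Longrightarrow> joinv g v w \<in> vecs n (g + f)"
  by (auto simp: vecs_def joinv_def)

lemma fstv_joinv: "v \<in> vecs n g \<Longrightarrow> fstv g (joinv g v w) = v"
  by (auto simp: vecs_def joinv_def fstv_def)

lemma sndv_joinv: "sndv g (joinv g v w) = w"
  by (auto simp: joinv_def sndv_def)

lemma joinv_fstv_sndv: "joinv g (fstv g v) (sndv g v) = v"
  by (auto simp: joinv_def fstv_def sndv_def)

lemma joinv_eq_0:
  assumes "joinv g v w = (\<lambda>_. 0)" "v \<in> vecs n g"
  shows "v j = 0" "w j = 0"
  using fun_cong[OF assms(1), of j] fun_cong[OF assms(1), of "g + j"] assms(2)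
  by (auto simp: joinv_def vecs_def split: if_splits)

abbreviation "H \<equiv> rh_diff fr d2 gr d1 lam"

abbreviation "hr \<equiv> rh_rank fr gr"

lemma H_1: "fr 0 = 1 \<Longrightarrow> mat_app (hr 0) (hr (Suc 0)) (H (Suc 0)) v j = - dF 0 (dG 0 v) j"
  unfolding dF_def dG_def gr_0 mat_app_mult
  by (simp add: mat_app_def rh_rank_def rh_diff_def sum_negf)

lemma H_2: "mat_app (hr (Suc 0)) (hr (Suc (Suc 0))) (H (Suc (Suc 0))) v j =
    dG (Suc 0) (fstv (gr (Suc (Suc 0))) v) j + L (Suc 0) (sndv (gr (Suc (Suc 0))) v) j"
  by (simp add: dG_def L_def mat_app_def rh_rank_def rh_diff_def sum_lessThan_add fstv_def sndv_def
      numeral_2_eq_2)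

lemma H_3: "mat_app (hr (Suc (Suc k))) (hr (Suc (Suc (Suc k)))) (H (Suc (Suc (Suc k)))) v =
    joinv (gr (Suc (Suc k)))
      (\<lambda>j. dG (Suc (Suc k)) (fstv (gr (Suc (Suc (Suc k)))) v) j +
           L (Suc (Suc k)) (sndv (gr (Suc (Suc (Suc k)))) v) j)
      (dF (Suc (Suc k)) (sndv (gr (Suc (Suc (Suc k)))) v))"
  by (rule ext) (auto simp: joinv_def dG_def L_def dF_def mat_app_def rh_rank_def rh_diff_def
      sum_lessThan_add fstv_def sndv_def)

lemma H_vecs_2:
  assumes "v \<in> vecs n (gr (Suc (Suc k)))" "w \<in> vecs n (fr (Suc (Suc k)))"
  shows "(\<lambda>j. dG (Suc k) v j + L (Suc k) w j) \<in> vecs n (gr (Suc k))"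
  using assms by (intro vecs_add dG_vecs L_vecs)

text \<open>Exactness of a mapping cone: lift \<open>w\<close> along F to \<open>w'\<close>; by
  anticommutation \<open>v\<close> minus \<open>L\<close> of \<open>w'\<close> is a cycle of G, and
  it lifts in turn.\<close>

lemma pair_exact:
  assumes v: "v \<in> vecs n (gr (Suc (Suc k)))" and w: "w \<in> vecs n (fr (Suc (Suc k)))"
    and dw: "\<And>j. dF (Suc k) w j = 0"
    and dv: "\<And>j. dG (Suc k) v j + L (Suc k) w j = 0"
  obtains v' w' where "v' \<in> vecs n (gr (Suc (Suc (Suc k))))" "w' \<in> vecs n (fr (Suc (Suc (Suc k))))"
    "v = (\<lambda>j. dG (Suc (Suc k)) v' j + L (Suc (Suc k)) w' j)" "w = dF (Suc (Suc k)) w'"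
proof -
  obtain w' where w': "w' \<in> vecs n (fr (Suc (Suc (Suc k))))" "w = dF (Suc (Suc k)) w'"
    using dF_exact[OF w dw] by blast
  have "dG (Suc k) (\<lambda>i. v i - L (Suc (Suc k)) w' i) j = 0" for j
    using dv[of j] dG_L[of "Suc k" w' j] unfolding w'(2)
    by (simp add: dG_def mat_app_diff)
  then obtain v' where v': "v' \<in> vecs n (gr (Suc (Suc (Suc k))))"
    "(\<lambda>i. v i - L (Suc (Suc k)) w' i) = dG (Suc (Suc k)) v'"
    using dG_exact[OF vecs_diff[OF v L_vecs[OF w'(1)]]] by blast
  have "v = (\<lambda>j. dG (Suc (Suc k)) v' j + L (Suc (Suc k)) w' j)"
    unfolding v'(2)[symmetric] by simp
  then show ?thesis using v' w' that by blast
qed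

lemma pair_complex:
  assumes v': "v' \<in> vecs n (gr (Suc (Suc (Suc k))))" and w': "w' \<in> vecs n (fr (Suc (Suc (Suc k))))"
  shows "dG (Suc k) (\<lambda>j. dG (Suc (Suc k)) v' j + L (Suc (Suc k)) w' j) j +
      L (Suc k) (dF (Suc (Suc k)) w') j = 0"
  using dG_dG[OF v', of j] dG_L[of "Suc k" w' j]
  by (simp add: dG_def[of "Suc k"] mat_app_add)

text \<open>If d''_1 d'_1 v = 0, then d'_1 v = d''_2 w for some \<open>w\<close>, which equals d'_1
  lambda_2 w by \<open>dG_L_0\<close>. So v - lambda_2 w is a cycle of G and a boundary.\<close>

lemma H_exact_1:
  assumes fr_0: "fr 0 = 1"
  shows "kern n (hr 0) (hr (Suc 0)) (H (Suc 0)) =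
    img n (hr (Suc 0)) (hr (Suc (Suc 0))) (H (Suc (Suc 0)))"
proof (intro equalityI subsetI)
  fix v assume "v \<in> kern n (hr 0) (hr (Suc 0)) (H (Suc 0))"
  then have v: "v \<in> vecs n (gr (Suc 0))" and dv: "\<And>j. mat_app (hr 0) (hr (Suc 0)) (H (Suc 0)) v j = 0"
    by (auto simp: kern_def rh_rank_def fun_eq_iff)
  have "dF 0 (dG 0 v) j = 0" for j
    using dv[of j] unfolding H_1[OF fr_0] by simp
  moreover have "dG 0 v \<in> vecs n (fr (Suc 0))"
    using dG_vecs[OF v] by (simp add: gr_0)
  ultimately obtain w where w: "w \<in> vecs n (fr (Suc (Suc 0)))" "dG 0 v = dF (Suc 0) w"
    using dF_exact by blast
  have "dG 0 (\<lambda>i. v i - L (Suc 0) w i) j = 0" for j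
    using dG_L_0[OF w(1)] fun_cong[OF w(2)] by (simp add: dG_def mat_app_diff)
  then obtain v' where v': "v' \<in> vecs n (gr (Suc (Suc 0)))"
    "(\<lambda>i. v i - L (Suc 0) w i) = dG (Suc 0) v'"
    using dG_exact[OF vecs_diff[OF v L_vecs[OF w(1)]]] by blast
  have "v = mat_app (hr (Suc 0)) (hr (Suc (Suc 0))) (H (Suc (Suc 0))) (joinv (gr (Suc (Suc 0))) v' w)"
    by (rule ext) (simp add: H_2 fstv_joinv[OF v'(1)] sndv_joinv v'(2)[symmetric])
  then show "v \<in> img n (hr (Suc 0)) (hr (Suc (Suc 0))) (H (Suc (Suc 0)))"
    unfolding img_def using joinv_vecs[OF v'(1) w(1)] by (auto simp: rh_rank_def)
next
  fix v assume "v \<in> img n (hr (Suc 0)) (hr (Suc (Suc 0))) (H (Suc (Suc 0)))"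
  then obtain x where x: "x \<in> vecs n (gr (Suc (Suc 0)) + fr (Suc (Suc 0)))"
    and v: "v = mat_app (hr (Suc 0)) (hr (Suc (Suc 0))) (H (Suc (Suc 0))) x"
    by (auto simp: img_def rh_rank_def)
  define y z where "y = fstv (gr (Suc (Suc 0))) x" and "z = sndv (gr (Suc (Suc 0))) x"
  have y: "y \<in> vecs n (gr (Suc (Suc 0)))" and z: "z \<in> vecs n (fr (Suc (Suc 0)))"
    using x by (auto simp: y_def z_def intro: fstv_vecs sndv_vecs)
  have v': "v = (\<lambda>j. dG (Suc 0) y j + L (Suc 0) z j)"
    unfolding v y_def z_def by (rule ext) (rule H_2)
  have "dG 0 v = dF (Suc 0) z"
    using dG_dG[OF y] dG_L_0[OF z] unfolding v' by (auto simp: dG_def[of 0] mat_app_add)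
  then have "- dF 0 (dG 0 v) j = 0" for j
    using dF_dF[OF z] by simp
  moreover have "v \<in> vecs n (hr (Suc 0))"
    using H_vecs_2[OF y z] by (simp add: v' rh_rank_def)
  ultimately show "v \<in> kern n (hr 0) (hr (Suc 0)) (H (Suc 0))"
    by (intro kernI) (simp_all only: H_1[OF fr_0])
qed

text \<open>The differential out of H_2 has no component in F_1, so the cycle condition on
  \<open>z\<close> must be recovered: applying d'_1 to d'_2 y + lambda_2 z = 0 leaves d''_2 z = 0.
  After that it is the cone argument.\<close>

lemma H_exact_2:
  "kern n (hr (Suc 0)) (hr (Suc (Suc 0))) (H (Suc (Suc 0))) =
    img n (hr (Suc (Suc 0))) (hr (Suc (Suc (Suc 0)))) (H (Suc (Suc (Suc 0))))"
proof (intro equalityI subsetI)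
  fix x assume "x \<in> kern n (hr (Suc 0)) (hr (Suc (Suc 0))) (H (Suc (Suc 0)))"
  then have x: "x \<in> vecs n (gr (Suc (Suc 0)) + fr (Suc (Suc 0)))"
    and dx: "\<And>j. mat_app (hr (Suc 0)) (hr (Suc (Suc 0))) (H (Suc (Suc 0))) x j = 0"
    by (auto simp: kern_def rh_rank_def fun_eq_iff)
  define y z where "y = fstv (gr (Suc (Suc 0))) x" and "z = sndv (gr (Suc (Suc 0))) x"
  have y: "y \<in> vecs n (gr (Suc (Suc 0)))" and z: "z \<in> vecs n (fr (Suc (Suc 0)))"
    using x by (auto simp: y_def z_def intro: fstv_vecs sndv_vecs)
  have d: "dG (Suc 0) y j + L (Suc 0) z j = 0" for j
    using dx[of j] unfolding H_2 y_def z_def .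
  then have "L (Suc 0) z = (\<lambda>i. - dG (Suc 0) y i)"
    by (simp add: fun_eq_iff add_eq_0_iff2 add_eq_0_iff)
  then have dz: "dF (Suc 0) z j = 0" for j
    using dG_L_0[OF z, of j] dG_dG[OF y, of j] by (simp add: dG_def[of 0] mat_app_uminus)
  obtain v' w' where vw: "v' \<in> vecs n (gr (Suc (Suc (Suc 0))))" "w' \<in> vecs n (fr (Suc (Suc (Suc 0))))"
    "y = (\<lambda>j. dG (Suc (Suc 0)) v' j + L (Suc (Suc 0)) w' j)" "z = dF (Suc (Suc 0)) w'"
    using pair_exact[OF y z dz d] by blast
  have "x = mat_app (hr (Suc (Suc 0))) (hr (Suc (Suc (Suc 0)))) (H (Suc (Suc (Suc 0))))
      (joinv (gr (Suc (Suc (Suc 0)))) v' w')"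
    unfolding H_3 fstv_joinv[OF vw(1)] sndv_joinv vw(3,4)[symmetric] y_def z_def joinv_fstv_sndv ..
  then show "x \<in> img n (hr (Suc (Suc 0))) (hr (Suc (Suc (Suc 0)))) (H (Suc (Suc (Suc 0))))"
    unfolding img_def using joinv_vecs[OF vw(1,2)] by (auto simp: rh_rank_def)
next
  fix x assume "x \<in> img n (hr (Suc (Suc 0))) (hr (Suc (Suc (Suc 0)))) (H (Suc (Suc (Suc 0))))"
  then obtain x' where x': "x' \<in> vecs n (gr (Suc (Suc (Suc 0))) + fr (Suc (Suc (Suc 0))))"
    and x: "x = mat_app (hr (Suc (Suc 0))) (hr (Suc (Suc (Suc 0)))) (H (Suc (Suc (Suc 0)))) x'"
    by (auto simp: img_def rh_rank_def)
  note vs = fstv_vecs[OF x'] sndv_vecs[OF x']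
  note x'' = x[unfolded H_3]
  show "x \<in> kern n (hr (Suc 0)) (hr (Suc (Suc 0))) (H (Suc (Suc 0)))"
  proof (rule kernI)
    show "x \<in> vecs n (hr (Suc (Suc 0)))"
      using joinv_vecs[OF H_vecs_2[OF vs] dF_vecs[OF vs(2)]] by (simp add: x'' rh_rank_def)
    show "mat_app (hr (Suc 0)) (hr (Suc (Suc 0))) (H (Suc (Suc 0))) x j = 0" for j
      unfolding H_2 x'' fstv_joinv[OF H_vecs_2[OF vs]] sndv_joinv by (rule pair_complex[OF vs])
  qed
qed

lemma H_exact_3:
  "kern n (hr (Suc (Suc k))) (hr (Suc (Suc (Suc k)))) (H (Suc (Suc (Suc k)))) =
    img n (hr (Suc (Suc (Suc k)))) (hr (Suc (Suc (Suc (Suc k))))) (H (Suc (Suc (Suc (Suc k)))))"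
  (is "?K = ?I")
proof (intro equalityI subsetI)
  fix x assume "x \<in> ?K"
  then have x: "x \<in> vecs n (gr (Suc (Suc (Suc k))) + fr (Suc (Suc (Suc k))))"
    and dx: "mat_app (hr (Suc (Suc k))) (hr (Suc (Suc (Suc k)))) (H (Suc (Suc (Suc k)))) x = (\<lambda>_. 0)"
    by (auto simp: kern_def rh_rank_def)
  define y z where "y = fstv (gr (Suc (Suc (Suc k)))) x" and "z = sndv (gr (Suc (Suc (Suc k)))) x"
  have y: "y \<in> vecs n (gr (Suc (Suc (Suc k))))" and z: "z \<in> vecs n (fr (Suc (Suc (Suc k))))"
    using x by (auto simp: y_def z_def intro: fstv_vecs sndv_vecs)
  have "joinv (gr (Suc (Suc k))) (\<lambda>j. dG (Suc (Suc k)) y j + L (Suc (Suc k)) z j)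
      (dF (Suc (Suc k)) z) = (\<lambda>_. 0)"
    using dx unfolding H_3 y_def z_def .
  note d = joinv_eq_0[OF this H_vecs_2[OF y z]]
  obtain v' w' where vw: "v' \<in> vecs n (gr (Suc (Suc (Suc (Suc k)))))"
    "w' \<in> vecs n (fr (Suc (Suc (Suc (Suc k)))))"
    "y = (\<lambda>j. dG (Suc (Suc (Suc k))) v' j + L (Suc (Suc (Suc k))) w' j)"
    "z = dF (Suc (Suc (Suc k))) w'"
    using pair_exact[OF y z d(2,1)] by blast
  have "x = mat_app (hr (Suc (Suc (Suc k)))) (hr (Suc (Suc (Suc (Suc k))))) (H (Suc (Suc (Suc (Suc k)))))
      (joinv (gr (Suc (Suc (Suc (Suc k))))) v' w')"
    unfolding H_3 fstv_joinv[OF vw(1)] sndv_joinv vw(3,4)[symmetric] y_def z_def joinv_fstv_sndv ..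
  then show "x \<in> ?I"
    unfolding img_def using joinv_vecs[OF vw(1,2)] by (auto simp: rh_rank_def)
next
  fix x assume "x \<in> ?I"
  then obtain x' where x': "x' \<in> vecs n (gr (Suc (Suc (Suc (Suc k)))) + fr (Suc (Suc (Suc (Suc k)))))"
    and x: "x = mat_app (hr (Suc (Suc (Suc k)))) (hr (Suc (Suc (Suc (Suc k)))))
      (H (Suc (Suc (Suc (Suc k))))) x'"
    by (auto simp: img_def rh_rank_def)
  note vs = fstv_vecs[OF x'] sndv_vecs[OF x']
  note x'' = x[unfolded H_3]
  show "x \<in> ?K"
  proof (rule kernI)
    show "x \<in> vecs n (hr (Suc (Suc (Suc k))))"
      using joinv_vecs[OF H_vecs_2[OF vs] dF_vecs[OF vs(2)]] by (simp add: x'' rh_rank_def)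
    show "mat_app (hr (Suc (Suc k))) (hr (Suc (Suc (Suc k)))) (H (Suc (Suc (Suc k)))) x j = 0" for j
      unfolding H_3 x'' fstv_joinv[OF H_vecs_2[OF vs]] sndv_joinv pair_complex[OF vs]
      using dF_dF[OF vs(2)] by (simp add: joinv_def)
  qed
qed

lemma H_exact:
  assumes "fr 0 = 1"
  shows "kern n (hr k) (hr (Suc k)) (H (Suc k)) = img n (hr (Suc k)) (hr (Suc (Suc k))) (H (Suc (Suc k)))"
proof (cases k)
  case 0
  then show ?thesis using H_exact_1[OF assms] by simp
next
  case k: (Suc k')
  show ?thesis
  proof (cases k')
    case 0
    then show ?thesis using H_exact_2 k by simp
  next
    case (Suc k'')
    then show ?thesis using H_exact_3[of k''] k by simp
  qed
qed

end

section \<open>Minimality of the horseshoe maps\<close>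

context horseshoe
begin

lemma d2_d2:
  assumes "j < fr k" "i < fr (Suc (Suc k))"
  shows "(\<Sum>t<fr (Suc k). d2 (Suc k) j t * d2 (Suc (Suc k)) t i) = 0"
proof -
  define e :: "'k mvec" where "e = (\<lambda>t. if t = i then 1 else 0)"
  have "e \<in> vecs n (fr (Suc (Suc k)))"
    using assms by (simp add: e_def vecs_def)
  then have "dF k (dF (Suc k) e) j = 0"
    by (rule dF_dF)
  moreover have "dF (Suc k) e t = d2 (Suc (Suc k)) t i" if "t < fr (Suc k)" for t
    using that assms by (simp add: dF_def mat_app_def e_def if_distrib[of "\<lambda>x. _ * x"] cong: if_cong)
  ultimately show ?thesis
    using assms by (simp add: dF_def[of k] mat_app_def cong: sum.cong_simp)
qed

lemma lift_d1:
  fixes M :: "nat \<Rightarrow> nat \<Rightarrow> 'k mpoly"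
  assumes "\<And>j i. j < gr (Suc k) \<Longrightarrow> i < r \<Longrightarrow> M j i \<in> polys n"
    and "\<And>j i. j < gr k \<Longrightarrow> i < r \<Longrightarrow> (\<Sum>t<gr (Suc k). d1 (Suc k) j t * M t i) = 0"
  obtains N where "\<And>j i. j < gr (Suc (Suc k)) \<Longrightarrow> i < r \<Longrightarrow> N j i \<in> polys n"
    and "\<And>j i. j < gr (Suc k) \<Longrightarrow> i < r \<Longrightarrow>
      M j i = (\<Sum>t<gr (Suc (Suc k)). d1 (Suc (Suc k)) j t * N t i)"
proof -
  have "\<exists>w. w \<in> vecs n (gr (Suc (Suc k))) \<and>
      (\<forall>j<gr (Suc k). M j i = (\<Sum>t<gr (Suc (Suc k)). d1 (Suc (Suc k)) j t * w t))" if i: "i < r" for i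
  proof -
    define v where "v = (\<lambda>j. if j < gr (Suc k) then M j i else 0)"
    have "v \<in> vecs n (gr (Suc k))"
      using assms(1) i by (simp add: vecs_def v_def)
    moreover have "dG k v j = 0" for j
      using assms(2) i by (simp add: dG_def mat_app_def v_def)
    ultimately obtain w where "w \<in> vecs n (gr (Suc (Suc k)))" "v = dG (Suc k) w"
      using dG_exact by blast
    moreover have "M j i = v j" if "j < gr (Suc k)" for j
      using that by (simp add: v_def)
    ultimately show ?thesis
      by (auto simp: dG_def mat_app_def)
  qed
  then obtain w where w: "\<And>i. i < r \<Longrightarrow> w i \<in> vecs n (gr (Suc (Suc k)))"
    "\<And>i j. i < r \<Longrightarrow> j < gr (Suc k) \<Longrightarrow>
      M j i = (\<Sum>t<gr (Suc (Suc k)). d1 (Suc (Suc k)) j t * w i t)"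
    by metis
  show ?thesis
    by (rule that[of "\<lambda>j i. w i j"]) (use w in \<open>auto simp: vecs_def\<close>)
qed

end

text \<open>\<open>syzygies\<close> and \<open>powers\<close> state on generators the two inclusions
  between which the Koszul complexes are placed. Special ideals enter only through them.\<close>

locale minimal_horseshoe = horseshoe n fr gr d2 d1 lam
  for n :: nat and fr gr :: "nat \<Rightarrow> nat" and d2 d1 lam :: "nat \<Rightarrow> ('k::field) mmat" +
  fixes q l :: nat
  assumes q_pos: "q > 0"
    and l_le: "l \<le> n"
    and d2_minimal: "\<And>k j i. j < fr k \<Longrightarrow> i < fr (Suc k) \<Longrightarrow> lkp (d2 (Suc k) j i) 0 = 0"
    and d1_minimal: "\<And>k j i. j < gr k \<Longrightarrow> i < gr (Suc k) \<Longrightarrow> lkp (d1 (Suc k) j i) 0 = 0"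
    and syzygies: "\<And>j i m. j < fr (Suc 0) \<Longrightarrow> i < fr (Suc (Suc 0)) \<Longrightarrow>
      m \<in> kys (d2 (Suc (Suc 0)) j i) \<Longrightarrow> \<exists>t<l. q \<le> lkp m t"
    and powers: "\<And>t u. t < l \<Longrightarrow> u < fr (Suc 0) \<Longrightarrow>
      (\<lambda>j. if j = u then var t ^ (q - 1) else 0) \<in> img n (gr 0) (gr (Suc 0)) (d1 (Suc 0))"
begin

definition Kz :: "nat \<Rightarrow> nat set set" where
  "Kz k = {T. T \<subseteq> {..<l} \<and> card T = k}"

lemma Kz_D: "T \<in> Kz k \<Longrightarrow> T \<subseteq> {..<l} \<and> card T = k \<and> finite T"
  using finite_subset[of T "{..<l}"] by (simp add: Kz_def)

lemma Kz_finite: "T \<in> Kz k \<Longrightarrow> finite T"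
  by (simp add: Kz_D)

lemma finite_Kz: "finite (Kz k)"
proof (rule finite_subset)
  show "Kz k \<subseteq> Pow {..<l}"
    by (auto simp: Kz_def)
qed simp

lemma Kz_0: "Kz 0 = {{}}"
proof
  show "Kz 0 \<subseteq> {{}}"
  proof
    fix T assume "T \<in> Kz 0"
    then show "T \<in> {{}}"
      using Kz_D[of T 0] card_eq_0_iff[of T] by blast
  qed
qed (simp add: Kz_def)

lemma Kz_insert:
  assumes "T \<in> Kz k" "t \<in> {..<l} - T"
  shows "insert t T \<in> Kz (Suc k)"
  using Kz_D[OF assms(1)] assms(2) by (simp add: Kz_def)

lemma Kz_remove:
  assumes "T \<in> Kz (Suc k)" "t \<in> T"
  shows "T - {t} \<in> Kz k"
  using Kz_D[OF assms(1)] assms(2) by (auto simp: Kz_def)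

text \<open>Counts pairs of a set and a marked element in two ways. This transposes the Koszul
  differential, from its action on basis vectors (used for G) to its action on coefficients (used
  for \<open>alpha\<close>).\<close>

lemma sum_Kz_remove:
  "(\<Sum>T\<in>Kz (Suc k). \<Sum>t\<in>T. F t (T - {t})) =
   (\<Sum>T\<in>Kz k. \<Sum>t\<in>{..<l} - T. (F t T :: 'b::comm_monoid_add))"
proof -
  have "(\<Sum>T\<in>Kz (Suc k). \<Sum>t\<in>T. F t (T - {t})) =
      (\<Sum>(T, t)\<in>Sigma (Kz (Suc k)) (\<lambda>T. T). F t (T - {t}))"
    by (rule sum.Sigma) (auto simp: finite_Kz Kz_finite)
  also have "\<dots> = (\<Sum>(T, t)\<in>Sigma (Kz k) (\<lambda>T. {..<l} - T). F t T)"
  proof (rule sum.reindex_bij_witness[where j = "\<lambda>(T, t). (T - {t}, t)" and i = "\<lambda>(T, t). (insert t T, t)"])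
    fix x assume "x \<in> Sigma (Kz (Suc k)) (\<lambda>T. T)"
    then show "(case case x of (T, t) \<Rightarrow> (T - {t}, t) of (T, t) \<Rightarrow> (insert t T, t)) = x"
      and "(case x of (T, t) \<Rightarrow> (T - {t}, t)) \<in> Sigma (Kz k) (\<lambda>T. {..<l} - T)"
      and "(case case x of (T, t) \<Rightarrow> (T - {t}, t) of (T, t) \<Rightarrow> F t T) = (case x of (T, t) \<Rightarrow> F t (T - {t}))"
      using Kz_remove by (auto simp: Kz_def split: prod.splits)
  next
    fix x assume "x \<in> Sigma (Kz k) (\<lambda>T. {..<l} - T)"
    then show "(case case x of (T, t) \<Rightarrow> (insert t T, t) of (T, t) \<Rightarrow> (T - {t}, t)) = x"
      and "(case x of (T, t) \<Rightarrow> (insert t T, t)) \<in> Sigma (Kz (Suc k)) (\<lambda>T. T)"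
      using Kz_insert by (auto split: prod.splits)
  qed
  also have "\<dots> = (\<Sum>T\<in>Kz k. \<Sum>t\<in>{..<l} - T. F t T)"
    by (rule sum.Sigma[symmetric]) (auto simp: finite_Kz)
  finally show ?thesis .
qed

text \<open>A chain map from \<open>F\<close>, shifted by one, to \<open>K(x_0^q, \<dots>, x_{l-1}^q) \<otimes> F_1\<close>:
  \<open>alpha k i T u\<close> is the coefficient at \<open>e_T \<otimes> f_u\<close> of the image of the \<open>i\<close>-th basis
  vector of \<open>F_{k+1}\<close>.\<close>

primrec alpha :: "nat \<Rightarrow> nat \<Rightarrow> nat set \<Rightarrow> nat \<Rightarrow> 'k mpoly" where
  "alpha 0 i T u = (if u = i then - 1 else 0)"
| "alpha (Suc k) i T u = - lowdiv q (Min T)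
     (\<Sum>i'<fr (Suc k). alpha k i' (T - {Min T}) u * d2 (Suc (Suc k)) i' i)"

lemma alpha_polys: "i < fr (Suc k) \<Longrightarrow> alpha k i T u \<in> polys n"
proof (induction k arbitrary: i T)
  case (Suc k)
  show ?case
    unfolding alpha.simps polys_uminus
    by (intro lowdiv_polys polys_sum polys_mult Suc.IH d2_polys) (use Suc.prems in auto)
qed simp

text \<open>For \<open>k = 0\<close>, \<open>syzygies\<close> puts the entries of d''_2 into the
  ideal of the x_t^q. Afterwards the induction hypothesis and d'' d'' = 0 make the right-hand side a
  Koszul cycle, and \<open>alpha\<close> was defined by contracting it.\<close>

lemma alpha_chain:
  assumes "T \<in> Kz k" "u < fr (Suc 0)" "i < fr (Suc (Suc k))"
  shows "(\<Sum>t\<in>{..<l} - T. ksgn t T * var t ^ q * alpha (Suc k) i (insert t T) u) =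
    - (\<Sum>i'<fr (Suc k). alpha k i' T u * d2 (Suc (Suc k)) i' i)"
  using assms
proof (induction k arbitrary: T i)
  case 0
  define f where "f = - d2 (Suc (Suc 0)) u i"
  have T: "T = {}" using 0 by (simp add: Kz_0)
  have sum: "(\<Sum>i'<fr (Suc 0). alpha 0 i' U u * d2 (Suc (Suc 0)) i' i) = f" for U
  proof -
    have "(\<Sum>i'<fr (Suc 0). alpha 0 i' U u * d2 (Suc (Suc 0)) i' i) =
        (\<Sum>i'<fr (Suc 0). if u = i' then - d2 (Suc (Suc 0)) i' i else 0)"
      by (intro sum.cong refl) simp
    then show ?thesis using 0 by (simp add: f_def)
  qed
  have "(\<Sum>t<l. var t ^ q * lowdiv q t f) = f"
    by (rule koszul_contraction_0) (use 0 syzygies[of u i] in \<open>auto simp: f_def in_keys_iff\<close>)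
  moreover have "ksgn t {} = (1 :: 'k mpoly)" for t
    by (rule ksgn_below) simp
  ultimately show ?case
    unfolding sum T alpha.simps(2) by (simp add: sum_negf)
next
  case (Suc k)
  define c where "c U = (\<Sum>i'<fr (Suc (Suc k)). alpha (Suc k) i' U u * d2 (Suc (Suc (Suc k))) i' i)" for U
  define U where "U = T - {Min T}"
  have T: "T \<noteq> {}" "T \<subseteq> {..<l}" "finite T"
    using Kz_D[OF Suc.prems(1)] by auto
  then have U: "U \<in> Kz k"
    unfolding U_def using Suc.prems by (intro Kz_remove) auto
  have "(\<Sum>t\<in>{..<l} - U. ksgn t U * var t ^ q * c (insert t U)) =
      (\<Sum>i'<fr (Suc (Suc k)). (\<Sum>t\<in>{..<l} - U. ksgn t U * var t ^ q * alpha (Suc k) i' (insert t U) u) *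
        d2 (Suc (Suc (Suc k))) i' i)"
    unfolding c_def sum_distrib_left sum_distrib_right by (subst sum.swap) (simp only: mult.assoc)
  also have "\<dots> = (\<Sum>i'<fr (Suc (Suc k)). - (\<Sum>t<fr (Suc k). alpha k t U u * d2 (Suc (Suc k)) t i') *
        d2 (Suc (Suc (Suc k))) i' i)"
    by (intro sum.cong refl arg_cong2[of _ _ _ _ "(*)"]) (use Suc.IH[OF U Suc.prems(2)] in auto)
  also have "\<dots> = - (\<Sum>t<fr (Suc k). alpha k t U u *
      (\<Sum>i'<fr (Suc (Suc k)). d2 (Suc (Suc k)) t i' * d2 (Suc (Suc (Suc k))) i' i))"
    unfolding sum_distrib_left sum_distrib_right sum_negf mult_minus_left
    by (subst sum.swap) (simp only: mult.assoc)
  also have "\<dots> = 0"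
    using Suc.prems by (simp add: d2_d2)
  finally have "(\<Sum>t\<in>{..<l} - T. ksgn t T * var t ^ q *
      lowdiv q (Min (insert t T)) (c (insert t T - {Min (insert t T)}))) = c T"
    unfolding U_def by (rule koszul_contraction[OF T(1,2)])
  then show ?case
    unfolding alpha.simps(2)[of "Suc k"] c_def by (simp only: mult_minus_right sum_negf)
qed

text \<open>A chain map from \<open>K(x_0^{q-1}, \<dots>, x_{l-1}^{q-1}) \<otimes> F_1\<close> to \<open>G\<close>.\<close>

lemma beta_exists:
  obtains b :: "nat \<Rightarrow> nat set \<Rightarrow> nat \<Rightarrow> nat \<Rightarrow> 'k mpoly"
  where "\<And>k T u j. T \<in> Kz k \<Longrightarrow> u < fr (Suc 0) \<Longrightarrow> j < gr k \<Longrightarrow> b k T u j \<in> polys n"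
    and "\<And>u j. b 0 {} u j = (if j = u then 1 else 0)"
    and "\<And>k T u j. T \<in> Kz (Suc k) \<Longrightarrow> u < fr (Suc 0) \<Longrightarrow> j < gr k \<Longrightarrow>
      (\<Sum>j'<gr (Suc k). d1 (Suc k) j j' * b (Suc k) T u j') =
      (\<Sum>t\<in>T. ksgn t T * var t ^ (q - 1) * b k (T - {t}) u j)"
proof -
  \<comment> \<open>Stage \<open>k\<close> carries the cycle condition that makes the choice of
    stage \<open>k + 1\<close> possible. At \<open>k = 0\<close> there is no exactness of G to use,
    and \<open>powers\<close> supplies the preimages instead.\<close>
  define P where "P k b \<longleftrightarrow> (\<forall>T\<in>Kz k. \<forall>u<fr (Suc 0). b T u \<in> vecs n (gr k)) \<and>
      (k = 0 \<longrightarrow> (\<forall>u j. b {} u j = (if j = u then 1 else 0))) \<and>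
      (k \<noteq> 0 \<longrightarrow> (\<forall>T\<in>Kz (Suc k). \<forall>u<fr (Suc 0). \<forall>j.
        dG (k - 1) (\<lambda>j. \<Sum>t\<in>T. ksgn t T * var t ^ (q - 1) * b (T - {t}) u j) j = 0))"
    for k and b :: "nat set \<Rightarrow> nat \<Rightarrow> 'k mvec"
  define Q where "Q k b b' \<longleftrightarrow> (\<forall>T\<in>Kz (Suc k). \<forall>u<fr (Suc 0).
      dG k (b' T u) = (\<lambda>j. \<Sum>t\<in>T. ksgn t T * var t ^ (q - 1) * b (T - {t}) u j))"
    for k and b b' :: "nat set \<Rightarrow> nat \<Rightarrow> 'k mvec"
  have vecs_rhs: "(\<lambda>j. \<Sum>t\<in>T. ksgn t T * var t ^ (q - 1) * b (T - {t}) u j) \<in> vecs n (gr k)"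
    if "P k b" "T \<in> Kz (Suc k)" "u < fr (Suc 0)" for k b T u
  proof -
    have "b (T - {t}) u \<in> vecs n (gr k)" if "t \<in> T" for t
      using that \<open>P k b\<close> \<open>T \<in> Kz (Suc k)\<close> \<open>u < fr (Suc 0)\<close> Kz_remove unfolding P_def by blast
    moreover have "t < n" if "t \<in> T" for t
      using that Kz_D[OF \<open>T \<in> Kz (Suc k)\<close>] l_le by auto
    ultimately have *: "var t \<in> polys n" "\<And>j. j < gr k \<Longrightarrow> b (T - {t}) u j \<in> polys n"
      "\<And>j. \<not> j < gr k \<Longrightarrow> b (T - {t}) u j = 0" if "t \<in> T" for t
      using that by (auto simp: vecs_def)
    show ?thesis
      unfolding vecs_def using * by (auto intro!: polys_sum polys_mult polys_power ksgn_polys sum.neutral)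
  qed
  have "\<exists>b. \<forall>k. P k (b k) \<and> Q k (b k) (b (Suc k))"
  proof (rule dependent_nat_choice)
    have "P 0 (\<lambda>T u j. if j = u then 1 else 0)"
      unfolding P_def Kz_0 vecs_def gr_0 by simp
    then show "\<exists>b. P 0 b" by blast
  next
    fix b k assume P: "P k b"
    have "\<exists>w. w \<in> vecs n (gr (Suc k)) \<and>
        dG k w = (\<lambda>j. \<Sum>t\<in>T. ksgn t T * var t ^ (q - 1) * b (T - {t}) u j)"
      if T: "T \<in> Kz (Suc k)" and u: "u < fr (Suc 0)" for T u
    proof (cases k)
      case 0
      then obtain t where t: "T = {t}" "t < l"
        using T by (auto simp: Kz_def card_1_singleton_iff)
      have "ksgn t {t} = (1 :: 'k mpoly)"
        by (rule ksgn_below) simp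
      then have "(\<lambda>j. \<Sum>t\<in>T. ksgn t T * var t ^ (q - 1) * b (T - {t}) u j) =
          (\<lambda>j. if j = u then var t ^ (q - 1) else 0)"
        using P 0 by (auto simp: P_def t)
      then show ?thesis
        using powers[OF t(2) u] 0 by (auto simp: img_def dG_def)
    next
      case (Suc k')
      have "dG k' (\<lambda>j. \<Sum>t\<in>T. ksgn t T * var t ^ (q - 1) * b (T - {t}) u j) j = 0" for j
        using P T u Suc by (auto simp: P_def)
      moreover have "(\<lambda>j. \<Sum>t\<in>T. ksgn t T * var t ^ (q - 1) * b (T - {t}) u j) \<in> vecs n (gr (Suc k'))"
        using vecs_rhs[OF P T u] unfolding Suc .
      ultimately obtain w where "w \<in> vecs n (gr (Suc (Suc k')))"
        "(\<lambda>j. \<Sum>t\<in>T. ksgn t T * var t ^ (q - 1) * b (T - {t}) u j) = dG (Suc k') w"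
        using dG_exact by blast
      then show ?thesis
        unfolding Suc by metis
    qed
    note ex = this
    define b' where "b' T u = (SOME w. w \<in> vecs n (gr (Suc k)) \<and>
        dG k w = (\<lambda>j. \<Sum>t\<in>T. ksgn t T * var t ^ (q - 1) * b (T - {t}) u j))" for T u
    have "b' T u \<in> vecs n (gr (Suc k)) \<and>
        dG k (b' T u) = (\<lambda>j. \<Sum>t\<in>T. ksgn t T * var t ^ (q - 1) * b (T - {t}) u j)"
      if "T \<in> Kz (Suc k)" "u < fr (Suc 0)" for T u
      unfolding b'_def by (rule someI_ex[OF ex[OF that]])
    then have b': "\<And>T u. T \<in> Kz (Suc k) \<Longrightarrow> u < fr (Suc 0) \<Longrightarrow> b' T u \<in> vecs n (gr (Suc k))"
      "\<And>T u. T \<in> Kz (Suc k) \<Longrightarrow> u < fr (Suc 0) \<Longrightarrow>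
        dG k (b' T u) = (\<lambda>j. \<Sum>t\<in>T. ksgn t T * var t ^ (q - 1) * b (T - {t}) u j)"
      by blast+
    have "dG k (\<lambda>j. \<Sum>t\<in>T. ksgn t T * var t ^ (q - 1) * b' (T - {t}) u j) j = 0"
      if T: "T \<in> Kz (Suc (Suc k))" and u: "u < fr (Suc 0)" for T u j
    proof -
      have "dG k (\<lambda>j. \<Sum>t\<in>T. ksgn t T * var t ^ (q - 1) * b' (T - {t}) u j) j =
          (\<Sum>t\<in>T. ksgn t T * var t ^ (q - 1) * dG k (b' (T - {t}) u) j)"
      proof (cases "j < gr k")
        case True
        have "(\<Sum>i<gr (Suc k). d1 (Suc k) j i * (\<Sum>t\<in>T. ksgn t T * var t ^ (q - 1) * b' (T - {t}) u i)) =
          (\<Sum>t\<in>T. ksgn t T * var t ^ (q - 1) * (\<Sum>i<gr (Suc k). d1 (Suc k) j i * b' (T - {t}) u i))"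
          unfolding sum_distrib_left by (subst sum.swap) (simp only: mult_ac)
        then show ?thesis using True by (simp add: dG_def mat_app_def)
      qed (simp add: dG_def mat_app_def)
      also have "\<dots> = (\<Sum>t\<in>T. ksgn t T * var t ^ (q - 1) *
          (\<Sum>s\<in>T - {t}. ksgn s (T - {t}) * var s ^ (q - 1) * b (T - {t} - {s}) u j))"
        by (intro sum.cong refl) (simp only: b'(2)[OF Kz_remove[OF T] u])
      also have "\<dots> = 0"
        using koszul_square_zero[OF Kz_finite[OF T], of "\<lambda>t. var t ^ (q - 1)" "\<lambda>T. b T u j"] .
      finally show ?thesis .
    qed
    then have "P (Suc k) b'"
      using b'(1) by (simp add: P_def)
    moreover have "Q k b b'"
      using b'(2) by (simp add: Q_def)
    ultimately show "\<exists>b'. P (Suc k) b' \<and> Q k b b'" by blast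
  qed
  then obtain b where b: "\<And>k. P k (b k)" "\<And>k. Q k (b k) (b (Suc k))"
    by blast
  show ?thesis
  proof (rule that[of b])
    show "b k T u j \<in> polys n" if "T \<in> Kz k" "u < fr (Suc 0)" "j < gr k" for k T u j
      using b(1)[of k] that unfolding P_def vecs_def by blast
    show "b 0 {} u j = (if j = u then 1 else 0)" for u j
      using b(1)[of 0] unfolding P_def by blast
    show "(\<Sum>j'<gr (Suc k). d1 (Suc k) j j' * b (Suc k) T u j') =
        (\<Sum>t\<in>T. ksgn t T * var t ^ (q - 1) * b k (T - {t}) u j)"
      if "T \<in> Kz (Suc k)" "u < fr (Suc 0)" "j < gr k" for k T u j
    proof -
      have "dG k (b (Suc k) T u) = (\<lambda>j. \<Sum>t\<in>T. ksgn t T * var t ^ (q - 1) * b k (T - {t}) u j)"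
        using b(2)[of k] that unfolding Q_def by blast
      from fun_cong[OF this, of j] show ?thesis
        using that by (simp add: dG_def mat_app_def)
    qed
  qed
qed

text \<open>Multiplying \<open>e_T\<close> by \<open>\<Prod>t\<in>T. x_t\<close> maps the Koszul complex of the \<open>q\<close>-th powers to that of
  the \<open>(q-1)\<close>-st powers, so the composite of the three chain maps lifts \<open>- id\<close> on \<open>F_1\<close> and is
  minimal in positive degrees.\<close>

lemma minimal_lift_exists:
  obtains mu :: "nat \<Rightarrow> nat \<Rightarrow> nat \<Rightarrow> 'k mpoly"
  where "\<And>k j i. j < gr k \<Longrightarrow> i < fr (Suc k) \<Longrightarrow> mu k j i \<in> polys n"
    and "\<And>j i. j < gr 0 \<Longrightarrow> i < fr (Suc 0) \<Longrightarrow> mu 0 j i = lam (Suc 0) j i"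
    and "\<And>k j i. j < gr k \<Longrightarrow> i < fr (Suc (Suc k)) \<Longrightarrow>
      (\<Sum>t<gr (Suc k). d1 (Suc k) j t * mu (Suc k) t i) =
      - (\<Sum>t<fr (Suc k). mu k j t * d2 (Suc (Suc k)) t i)"
    and "\<And>k j i. lkp (mu (Suc k) j i) 0 = 0"
proof -
  obtain b :: "nat \<Rightarrow> nat set \<Rightarrow> nat \<Rightarrow> nat \<Rightarrow> 'k mpoly"
    where b: "\<And>k T u j. T \<in> Kz k \<Longrightarrow> u < fr (Suc 0) \<Longrightarrow> j < gr k \<Longrightarrow> b k T u j \<in> polys n"
    and b_0: "\<And>u j. b 0 {} u j = (if j = u then 1 else 0)"
    and b_chain: "\<And>k T u j. T \<in> Kz (Suc k) \<Longrightarrow> u < fr (Suc 0) \<Longrightarrow> j < gr k \<Longrightarrow>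
      (\<Sum>j'<gr (Suc k). d1 (Suc k) j j' * b (Suc k) T u j') =
      (\<Sum>t\<in>T. ksgn t T * var t ^ (q - 1) * b k (T - {t}) u j)"
    using beta_exists by blast
  define X :: "nat set \<Rightarrow> 'k mpoly" where "X T = (\<Prod>t\<in>T. var t)" for T
  define mu where "mu k j i = (\<Sum>T\<in>Kz k. \<Sum>u<fr (Suc 0). X T * alpha k i T u * b k T u j)" for k j i
  have X_polys: "X T \<in> polys n" if "T \<in> Kz k" for k T
    unfolding X_def using that l_le by (intro polys_prod polys_var) (auto simp: Kz_def)
  show ?thesis
  proof (rule that[of mu])
    show "mu k j i \<in> polys n" if "j < gr k" "i < fr (Suc k)" for k j i
      unfolding mu_def using that b X_polys alpha_polys by (auto intro!: polys_sum polys_mult)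
  next
    fix j i assume "j < gr 0" "i < fr (Suc 0)"
    moreover have "mu 0 j i = (\<Sum>u<fr (Suc 0). if u = i then - (if j = u then 1 else 0) else 0)"
    proof -
      have "mu 0 j i = (\<Sum>u<fr (Suc 0). alpha 0 i {} u * b 0 {} u j)"
        by (simp add: mu_def Kz_0 X_def)
      also have "\<dots> = (\<Sum>u<fr (Suc 0). if u = i then - (if j = u then 1 else 0) else 0)"
        by (intro sum.cong refl) (simp add: b_0)
      finally show ?thesis .
    qed
    ultimately show "mu 0 j i = lam (Suc 0) j i"
      by (simp add: lam_Suc_0 gr_0)
  next
    fix k j i assume j: "j < gr k" and i: "i < fr (Suc (Suc k))"
    have "(\<Sum>t<gr (Suc k). d1 (Suc k) j t * mu (Suc k) t i) =
        (\<Sum>T\<in>Kz (Suc k). \<Sum>u<fr (Suc 0). X T * alpha (Suc k) i T u *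
          (\<Sum>t<gr (Suc k). d1 (Suc k) j t * b (Suc k) T u t))"
      unfolding mu_def sum_distrib_left
      by (rule trans[OF sum.swap], rule sum.cong[OF refl], rule trans[OF sum.swap]) (simp only: mult_ac)
    also have "\<dots> = (\<Sum>T\<in>Kz (Suc k). \<Sum>u<fr (Suc 0). X T * alpha (Suc k) i T u *
          (\<Sum>t\<in>T. ksgn t T * var t ^ (q - 1) * b k (T - {t}) u j))"
      using b_chain[OF _ _ j] by (intro sum.cong refl) simp
    also have "\<dots> = (\<Sum>T\<in>Kz (Suc k). \<Sum>t\<in>T. \<Sum>u<fr (Suc 0).
          X (T - {t}) * (ksgn t (T - {t}) * var t ^ q * alpha (Suc k) i (insert t (T - {t})) u) *
          b k (T - {t}) u j)"
    proof (rule sum.cong[OF refl])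
      fix T assume T: "T \<in> Kz (Suc k)"
      have "X T * alpha (Suc k) i T u * (ksgn t T * var t ^ (q - 1) * b k (T - {t}) u j) =
          X (T - {t}) * (ksgn t (T - {t}) * var t ^ q * alpha (Suc k) i (insert t (T - {t})) u) *
          b k (T - {t}) u j" if t: "t \<in> T" for t u
      proof -
        \<comment> \<open>The factor x_t of \<open>X T\<close> completes x_t^(q-1) to the x_t^q of
          the other Koszul differential.\<close>
        have "X T = var t * X (T - {t})"
          unfolding X_def by (rule prod.remove[OF Kz_finite[OF T] t])
        moreover have "ksgn t T = (ksgn t (T - {t}) :: 'k mpoly)"
          using ksgn_insert_ge[of t t "T - {t}"] t by (simp add: insert_absorb)
        moreover have "var t ^ q = var t * (var t ^ (q - 1) :: 'k mpoly)"
          using q_pos by (simp add: power_eq_if)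
        moreover have "insert t (T - {t}) = T"
          using t by blast
        ultimately show ?thesis
          by (simp only: mult_ac)
      qed
      then show "(\<Sum>u<fr (Suc 0). X T * alpha (Suc k) i T u *
          (\<Sum>t\<in>T. ksgn t T * var t ^ (q - 1) * b k (T - {t}) u j)) =
        (\<Sum>t\<in>T. \<Sum>u<fr (Suc 0).
          X (T - {t}) * (ksgn t (T - {t}) * var t ^ q * alpha (Suc k) i (insert t (T - {t})) u) *
          b k (T - {t}) u j)"
        unfolding sum_distrib_left by (subst sum.swap) (intro sum.cong refl, blast)
    qed
    \<comment> \<open>Summing over the smaller set exposes the left-hand side of
      \<open>alpha_chain\<close>.\<close>
    also have "\<dots> = (\<Sum>T\<in>Kz k. \<Sum>t\<in>{..<l} - T. \<Sum>u<fr (Suc 0).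
          X T * (ksgn t T * var t ^ q * alpha (Suc k) i (insert t T) u) * b k T u j)"
      by (rule sum_Kz_remove)
    also have "\<dots> = (\<Sum>T\<in>Kz k. \<Sum>u<fr (Suc 0).
          X T * (\<Sum>t\<in>{..<l} - T. ksgn t T * var t ^ q * alpha (Suc k) i (insert t T) u) * b k T u j)"
      unfolding sum_distrib_left sum_distrib_right by (rule sum.cong[OF refl], rule sum.swap)
    also have "\<dots> = (\<Sum>T\<in>Kz k. \<Sum>u<fr (Suc 0).
          X T * - (\<Sum>t<fr (Suc k). alpha k t T u * d2 (Suc (Suc k)) t i) * b k T u j)"
      using alpha_chain[OF _ _ i] by (intro sum.cong refl) simp
    also have "\<dots> = - (\<Sum>t<fr (Suc k). mu k j t * d2 (Suc (Suc k)) t i)"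
      unfolding mu_def sum_distrib_left sum_distrib_right mult_minus_left mult_minus_right sum_negf
      by (rule arg_cong[of _ _ uminus], rule trans[OF _ sum.swap], rule sum.cong[OF refl],
          rule trans[OF _ sum.swap]) (simp only: mult_ac)
    finally show "(\<Sum>t<gr (Suc k). d1 (Suc k) j t * mu (Suc k) t i) =
        - (\<Sum>t<fr (Suc k). mu k j t * d2 (Suc (Suc k)) t i)" .
  next
    fix k j i
    have "lkp (X T) 0 = 0" if T: "T \<in> Kz (Suc k)" for T
    proof -
      \<comment> \<open>Positive degree matters here: \<open>T\<close> is nonempty, so
        \<open>X T\<close> has a variable as a factor.\<close>
      obtain t where t: "t \<in> T"
        using T by (fastforce simp: Kz_def)
      have "X T = var t * X (T - {t})"
        unfolding X_def by (rule prod.remove[OF Kz_finite[OF T] t])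
      then show ?thesis
        by (simp only: lookup_mult_0 lookup_var_0 mult_zero_left)
    qed
    then show "lkp (mu (Suc k) j i) 0 = 0"
      unfolding mu_def by (simp add: lookup_sum lookup_mult_0)
  qed
qed

text \<open>\<open>lam\<close> and \<open>mu\<close> agree on F_1 and obey the same recursion, so
  their difference has the form d' h - h' d''. Each product in it has a factor without constant
  term.\<close>

lemma lam_minimal:
  assumes "j < gr (Suc k)" "i < fr (Suc (Suc k))"
  shows "lkp (lam (Suc (Suc k)) j i) 0 = 0"
proof -
  obtain mu :: "nat \<Rightarrow> nat \<Rightarrow> nat \<Rightarrow> 'k mpoly"
    where mu: "\<And>k j i. j < gr k \<Longrightarrow> i < fr (Suc k) \<Longrightarrow> mu k j i \<in> polys n"
    and mu_0: "\<And>j i. j < gr 0 \<Longrightarrow> i < fr (Suc 0) \<Longrightarrow> mu 0 j i = lam (Suc 0) j i"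
    and mu_chain: "\<And>k j i. j < gr k \<Longrightarrow> i < fr (Suc (Suc k)) \<Longrightarrow>
      (\<Sum>t<gr (Suc k). d1 (Suc k) j t * mu (Suc k) t i) =
      - (\<Sum>t<fr (Suc k). mu k j t * d2 (Suc (Suc k)) t i)"
    and mu_minimal: "\<And>k j i. lkp (mu (Suc k) j i) 0 = 0"
    using minimal_lift_exists by blast
  define D where "D k j i = lam (Suc k) j i - mu k j i" for k j i
  have D_polys: "D k j i \<in> polys n" if "j < gr k" "i < fr (Suc k)" for k j i
    using that mu lam_polys by (simp add: D_def)
  have D_chain: "(\<Sum>t<gr (Suc k). d1 (Suc k) j t * D (Suc k) t i) =
      - (\<Sum>t<fr (Suc k). D k j t * d2 (Suc (Suc k)) t i)" if "j < gr k" "i < fr (Suc (Suc k))" for k j i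
    using lam_chain[OF that] mu_chain[OF that] unfolding D_def mat_mult_def
    by (simp only: right_diff_distrib left_diff_distrib sum_subtractf) simp
  \<comment> \<open>\<open>h'\<close> is the homotopy one degree lower. It stays unconstrained
    because the induction only needs that its product with d'' is killed by the next d''.\<close>
  have homotopy: "\<exists>h h'. (\<forall>j<gr (Suc k). \<forall>i<fr (Suc k). h j i \<in> polys n) \<and>
      (\<forall>j<gr k. \<forall>i<fr (Suc k). D k j i =
        (\<Sum>t<gr (Suc k). d1 (Suc k) j t * h t i) - (\<Sum>t<fr k. h' j t * d2 (Suc k) t i))" for k
  proof (induction k)
    case 0
    show ?case
      by (rule exI[of _ "\<lambda>_ _. 0"], rule exI[of _ "\<lambda>_ _. 0"]) (simp add: D_def mu_0)
  next
    case (Suc k)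
    then obtain h h' where h: "\<And>j i. j < gr (Suc k) \<Longrightarrow> i < fr (Suc k) \<Longrightarrow> h j i \<in> polys n"
      and D: "\<And>j i. j < gr k \<Longrightarrow> i < fr (Suc k) \<Longrightarrow> D k j i =
        (\<Sum>t<gr (Suc k). d1 (Suc k) j t * h t i) - (\<Sum>t<fr k. h' j t * d2 (Suc k) t i)"
      by blast
    \<comment> \<open>Adding the previous homotopy turns the difference into a cycle for d', whose
      lift \<open>N\<close> is the next homotopy.\<close>
    define M where "M j i = D (Suc k) j i + (\<Sum>t<fr (Suc k). h j t * d2 (Suc (Suc k)) t i)" for j i
    have "M j i \<in> polys n" if "j < gr (Suc k)" "i < fr (Suc (Suc k))" for j i
      unfolding M_def using that D_polys h d2_polys by (auto intro!: polys_add polys_sum polys_mult)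
    moreover have "(\<Sum>t<gr (Suc k). d1 (Suc k) j t * M t i) = 0" if "j < gr k" "i < fr (Suc (Suc k))" for j i
    proof -
      have "(\<Sum>t<gr (Suc k). d1 (Suc k) j t * M t i) =
          (\<Sum>t<fr (Suc k). ((\<Sum>s<gr (Suc k). d1 (Suc k) j s * h s t) - D k j t) * d2 (Suc (Suc k)) t i)"
        unfolding M_def distrib_left sum.distrib D_chain[OF that] left_diff_distrib sum_subtractf
          sum_distrib_left sum_distrib_right
        by (subst (2) sum.swap) (simp add: mult.assoc)
      also have "\<dots> = (\<Sum>t<fr (Suc k). (\<Sum>s<fr k. h' j s * d2 (Suc k) s t) * d2 (Suc (Suc k)) t i)"
        using D[OF that(1)] by (intro sum.cong refl) simp
      also have "\<dots> = (\<Sum>s<fr k. h' j s * (\<Sum>t<fr (Suc k). d2 (Suc k) s t * d2 (Suc (Suc k)) t i))"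
        unfolding sum_distrib_left sum_distrib_right by (subst sum.swap) (simp only: mult.assoc)
      also have "\<dots> = 0"
        using d2_d2 that(2) by simp
      finally show ?thesis .
    qed
    ultimately obtain N where N: "\<And>j i. j < gr (Suc (Suc k)) \<Longrightarrow> i < fr (Suc (Suc k)) \<Longrightarrow> N j i \<in> polys n"
      "\<And>j i. j < gr (Suc k) \<Longrightarrow> i < fr (Suc (Suc k)) \<Longrightarrow>
        M j i = (\<Sum>t<gr (Suc (Suc k)). d1 (Suc (Suc k)) j t * N t i)"
      using lift_d1[where M = M and r = "fr (Suc (Suc k))" and k = k] by blast
    show ?case
    proof (intro exI conjI allI impI)
      show "N j i \<in> polys n" if "j < gr (Suc (Suc k))" "i < fr (Suc (Suc k))" for j i
        by (rule N(1)[OF that])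
      show "D (Suc k) j i = (\<Sum>t<gr (Suc (Suc k)). d1 (Suc (Suc k)) j t * N t i) -
          (\<Sum>t<fr (Suc k). h j t * d2 (Suc (Suc k)) t i)"
        if "j < gr (Suc k)" "i < fr (Suc (Suc k))" for j i
        unfolding N(2)[OF that, symmetric] M_def by simp
    qed
  qed
  obtain h h' where "D (Suc k) j i = (\<Sum>t<gr (Suc (Suc k)). d1 (Suc (Suc k)) j t * h t i) -
      (\<Sum>t<fr (Suc k). h' j t * d2 (Suc (Suc k)) t i)"
    using homotopy[of "Suc k"] assms by blast
  then have "lkp (D (Suc k) j i) 0 = 0"
    using assms by (simp add: lookup_minus lookup_sum lookup_mult_0 d1_minimal d2_minimal)
  then show ?thesis
    using mu_minimal[of k j i] by (simp add: D_def lookup_minus)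
qed

end

section \<open>Syzygies of the Frobenius powers\<close>

context
  fixes n l q a r :: nat and g :: "nat \<Rightarrow> ('k::field) mpoly" and D :: "nat \<Rightarrow> int"
  assumes q_pos: "q > 0" and l_le: "l \<le> n"
    and gens: "\<And>f. f \<in> frob_ideal n l q a \<Longrightarrow> \<exists>w\<in>vecs n r. f = (\<Sum>u<r. g u * w u)"
    and gens_mem: "\<And>u. u < r \<Longrightarrow> g u \<in> frob_ideal n l q a"
    and gens_minimal: "\<And>w u. w \<in> vecs n r \<Longrightarrow> (\<Sum>u<r. g u * w u) = 0 \<Longrightarrow> u < r \<Longrightarrow> lkp (w u) 0 = 0"
    and gens_homog: "\<And>u. u < r \<Longrightarrow> homog (g u) (D u)"
begin

text \<open>By \<open>wt_reduce\<close> every monomial of \<open>f\<close> is a variable times a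
  monomial still in the ideal. Expanding the latter in the generators puts that variable into all
  coefficients.\<close>

lemma high_degree_combination:
  assumes "f \<in> polys n" "\<And>m. m \<in> kys f \<Longrightarrow> a \<le> wt l q m \<and> q * a < mdeg m"
  shows "\<exists>w\<in>vecs n r. (\<forall>u. lkp (w u) 0 = 0) \<and> f = (\<Sum>u<r. g u * w u)"
proof -
  have "\<exists>w\<in>vecs n r. (\<forall>u. lkp (w u) 0 = 0) \<and> (\<Sum>m\<in>X. sngl m (lkp f m)) = (\<Sum>u<r. g u * w u)"
    if "finite X" "X \<subseteq> kys f" for X
    using that
  proof (induction X rule: finite_induct)
    case empty
    show ?case
      by (rule bexI[of _ "\<lambda>_. 0"]) (simp_all add: vecs_def)
  next
    case (insert m X)
    then obtain w where w: "w \<in> vecs n r" "\<And>u. lkp (w u) 0 = 0"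
      "(\<Sum>m\<in>X. sngl m (lkp f m)) = (\<Sum>u<r. g u * w u)"
      by auto
    have m: "m \<in> kys f" using insert.prems by simp
    obtain i m' where m': "m = sngl i 1 + m'" "a \<le> wt l q m'"
      using wt_reduce[OF q_pos] assms(2)[OF m] by blast
    have "kys m \<subseteq> {..<n}"
      using assms(1) m by (auto simp: polys_def)
    then have n: "kys m' \<subseteq> {..<n}" "i < n"
      unfolding m'(1) expo_keys_add by simp_all
    obtain w' where w': "w' \<in> vecs n r" "sngl m' (lkp f m) = (\<Sum>u<r. g u * w' u)"
      using gens[OF frob_ideal_single[OF q_pos l_le n(1) m'(2)]] by blast
    have "sngl m (lkp f m) = var i * sngl m' (lkp f m)"
      unfolding var_def m'(1) mult_single by simp
    also have "\<dots> = (\<Sum>u<r. g u * (var i * w' u))"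
      unfolding w'(2) sum_distrib_left by (intro sum.cong refl) (simp only: mult_ac)
    finally have sngl: "sngl m (lkp f m) = (\<Sum>u<r. g u * (var i * w' u))" .
    show ?case
    proof (intro bexI conjI allI)
      show "(\<lambda>u. var i * w' u + w u) \<in> vecs n r"
        using w(1) w'(1) n(2) by (simp add: vecs_def)
      show "lkp (var i * w' u + w u) 0 = 0" for u
        by (simp add: lookup_add lookup_mult_0 w(2))
      show "(\<Sum>m\<in>insert m X. sngl m (lkp f m)) = (\<Sum>u<r. g u * (var i * w' u + w u))"
        unfolding sum.insert[OF insert.hyps] w(3) sngl distrib_left sum.distrib ..
    qed
  qed
  from this[of "kys f"] show ?thesis
    by (simp add: poly_mapping_sum_single)
qed

text \<open>The Nakayama argument: a generator of degree above \<open>q * a\<close> would be a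
  combination of generators with coefficients lacking constant terms.\<close>

lemma gens_degree:
  assumes u: "u < r" and m: "m \<in> kys (g u)"
  shows "mdeg m = q * a"
proof (rule ccontr)
  assume ne: "mdeg m \<noteq> q * a"
  have wt: "a \<le> wt l q m'" if "m' \<in> kys (g u)" for m'
    using frob_ideal_keys[OF q_pos gens_mem[OF u] that] .
  have "q * a \<le> mdeg m"
    using mult_le_mono2[OF wt[OF m], of q] wt_le_mdeg[of q l m] by (rule le_trans)
  moreover have "mdeg m' = mdeg m" if "m' \<in> kys (g u)" for m'
  proof -
    have "int (mdeg m') = D u" "int (mdeg m) = D u"
      using gens_homog[OF u] m that unfolding homog_def by blast+
    then show ?thesis by linarith
  qed
  ultimately have "a \<le> wt l q m' \<and> q * a < mdeg m'" if "m' \<in> kys (g u)" for m'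
    using wt that ne by simp
  moreover have "g u \<in> polys n"
    using gens_mem[OF u] is_ideal_frob[OF l_le] unfolding is_ideal_def by blast
  ultimately obtain w where w: "w \<in> vecs n r" "\<And>u. lkp (w u) 0 = 0" "g u = (\<Sum>u<r. g u * w u)"
    using high_degree_combination by blast
  \<comment> \<open>A relation among the generators with constant term 1 at \<open>u\<close>,
    contradicting minimality.\<close>
  define e where "e = (\<lambda>t. (if t = u then 1 else 0) - w t)"
  have "e \<in> vecs n r"
    using w(1) u by (auto simp: e_def vecs_def)
  moreover have "(\<Sum>t<r. g t * e t) = (\<Sum>t<r. if t = u then g t else 0) - (\<Sum>t<r. g t * w t)"
    unfolding sum_subtractf[symmetric] e_def
    by (intro sum.cong refl) (simp add: right_diff_distrib)
  then have "(\<Sum>t<r. g t * e t) = 0"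
    unfolding w(3)[symmetric] using u by simp
  ultimately have "lkp (e u) 0 = 0"
    using gens_minimal u by blast
  then show False
    by (simp add: e_def lookup_minus w(2))
qed

text \<open>Weight at least \<open>a\<close> in degree \<open>q * a\<close> forces equality in
  \<open>wt_le_mdeg\<close>: the generators are polynomials in the x_i^q.\<close>

lemma gens_pure:
  assumes "u < r" "m \<in> kys (g u)"
  shows "kys m \<subseteq> {..<l}" "q dvd lkp m i"
proof -
  have "a \<le> wt l q m"
    using frob_ideal_keys[OF q_pos gens_mem[OF assms(1)] assms(2)] .
  then have "mdeg m \<le> q * wt l q m"
    using gens_degree[OF assms] by simp
  then have eq: "q * wt l q m = mdeg m"
    using wt_le_mdeg[of q l m] by simp
  show "kys m \<subseteq> {..<l}" "q dvd lkp m i"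
    by (rule wt_eq_mdeg[OF eq])+
qed

text \<open>Over the ring generated by the \<open>q\<close>-th powers of the first \<open>l\<close> variables the polynomial
  ring is free on the monomials with small exponents.  The part of a syzygy along such a basis
  monomial has constant leading part, which vanishes because the generators, being of one
  degree, are linearly independent over the field.\<close>

lemma syzygy_keys:
  assumes v: "v \<in> vecs n r" "(\<Sum>u<r. g u * v u) = 0" and u: "u < r" and e: "e \<in> kys (v u)"
  shows "\<exists>t<l. q \<le> lkp e t"
proof (rule ccontr)
  assume no: "\<not> (\<exists>t<l. q \<le> lkp e t)"
  have small: "lkp e t < q" if "t < l" for t
    using no that by (cases "lkp e t < q") (simp_all only: not_less, blast)
  \<comment> \<open>\<open>M\<close> is an exponent of a generator, so modulo \<open>q\<close> the
    sum \<open>M + e\<close> remembers \<open>e\<close> in the first \<open>l\<close> variables.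
    This rules out any second pair.\<close>
  have coeff: "lkp (g s * v s) (M + e) = lkp (g s) M * lkp (v s) e"
    if s: "s < r" and t: "t < r" "M \<in> kys (g t)" for s t M
  proof -
    have "b = M \<and> e' = e" if b: "b \<in> kys (g s)" and eq: "b + e' = M + e" for b e'
    proof -
      \<comment> \<open>In the first \<open>l\<close> variables, a multiple of \<open>q\<close> that
        is at most \<open>lkp M i + lkp e i\<close> is at most \<open>lkp M i\<close>, because
        \<open>lkp e i < q\<close>. Equal degrees then turn \<open>b\<close> below \<open>M\<close>
        into equality.\<close>
      have le: "lkp b i \<le> lkp M i" for i
      proof (cases "i < l")
        case True
        obtain x y where xy: "lkp b i = q * x" "lkp M i = q * y"
          using gens_pure(2)[OF s b, of i] gens_pure(2)[OF t, of i] unfolding dvd_def by blast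
        have "lkp b i + lkp e' i = lkp M i + lkp e i"
          using arg_cong[OF eq, of "\<lambda>z. lkp z i"] by (simp add: lookup_add)
        then have "q * x < q * Suc y"
          using small[OF True] xy by simp
        then have "x < Suc y"
          by (simp only: mult_less_cancel1)
        then show ?thesis
          using xy by simp
      next
        case False
        then have "i \<notin> kys b"
          using gens_pure(1)[OF s b] by auto
        then show ?thesis
          by (simp add: not_in_keys_iff_lookup_eq_zero)
      qed
      have M: "M = b + (M - b)"
        by (rule poly_mapping_eqI) (simp add: lookup_add lookup_minus le)
      have "mdeg M = mdeg b + mdeg (M - b)"
        using arg_cong[OF M, of mdeg] by (simp only: mdeg_add)
      then have "mdeg (M - b) = 0"
        using gens_degree[OF s b] gens_degree[OF t] by simp
      then have 0: "M - b = 0"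
        by (simp only: mdeg_eq_0_iff)
      have "M = b"
        using M unfolding 0 by (simp only: add_0_right)
      then show "b = M \<and> e' = e"
        using eq by simp
    qed
    from lookup_mult_unique[of "g s" "v s" M e, OF this] show ?thesis .
  qed
  \<comment> \<open>The coefficients of \<open>v\<close> at \<open>e\<close> form a relation over
    the field; its value at \<open>u\<close> is nonzero by the choice of \<open>e\<close>.\<close>
  define w :: "nat \<Rightarrow> 'k mpoly" where "w = (\<lambda>s. if s < r then sngl 0 (lkp (v s) e) else 0)"
  have "w \<in> vecs n r"
    by (simp add: w_def vecs_def polys_single)
  moreover have "(\<Sum>s<r. g s * w s) = 0"
  proof (rule poly_mapping_eqI)
    fix M
    have *: "lkp (\<Sum>s<r. g s * w s) M = (\<Sum>s<r. lkp (g s) M * lkp (v s) e)"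
      unfolding lookup_sum by (intro sum.cong refl) (simp add: w_def lookup_mult_const)
    show "lkp (\<Sum>s<r. g s * w s) M = lkp 0 M"
    proof (cases "\<exists>t<r. M \<in> kys (g t)")
      case True
      then obtain t where t: "t < r" "M \<in> kys (g t)" by blast
      have "(\<Sum>s<r. lkp (g s) M * lkp (v s) e) = lkp (\<Sum>s<r. g s * v s) (M + e)"
        unfolding lookup_sum by (intro sum.cong refl) (use coeff t in simp)
      then show ?thesis
        unfolding * v(2) by simp
    next
      case False
      then have "M \<notin> kys (g s)" if "s < r" for s
        using that by blast
      then have "lkp (g s) M = 0" if "s < r" for s
        using that unfolding not_in_keys_iff_lookup_eq_zero[symmetric] by blast
      then show ?thesis
        unfolding * by simp
    qed
  qed
  ultimately have "lkp (w u) 0 = 0"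
    using gens_minimal u by blast
  then show False
    using e u by (simp add: w_def in_keys_iff)
qed

end

section \<open>Transfer to minimal resolutions\<close>

lemma cyclic_res_D:
  assumes "cyclic_res n r dg d I"
  shows "r 0 = 1" "dg 0 0 = 0" "minimal_graded_free_res n r dg d (ideal_vecs n I)"
  using assms by (auto simp: cyclic_res_def)

lemma minimal_res_D:
  assumes "minimal_graded_free_res n r dg d U"
  shows "\<And>k j i. j < r k \<Longrightarrow> i < r (Suc k) \<Longrightarrow> d (Suc k) j i \<in> polys n"
    and "\<And>k j i. j < r k \<Longrightarrow> i < r (Suc k) \<Longrightarrow> homog (d (Suc k) j i) (dg (Suc k) i - dg k j)"
    and "\<And>k. kern n (r k) (r (Suc k)) (d (Suc k)) = img n (r (Suc k)) (r (Suc (Suc k))) (d (Suc (Suc k)))"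
    and "img n (r 0) (r (Suc 0)) (d (Suc 0)) = U"
    and "\<And>k j i. j < r k \<Longrightarrow> i < r (Suc k) \<Longrightarrow> lkp (d (Suc k) j i) 0 = 0"
proof -
  have g: "graded_map n (r (Suc k)) (dg (Suc k)) (r k) (dg k) (d (Suc k))"
    and e: "kern n (r k) (r (Suc k)) (d (Suc k)) = img n (r (Suc k)) (r (Suc (Suc k))) (d (Suc (Suc k)))"
    and m: "\<forall>j<r k. \<forall>i<r (Suc k). \<not> nonzero_const (d (Suc k) j i)" for k
  proof -
    have *: "\<forall>k\<ge>1. graded_map n (r k) (dg k) (r (k-1)) (dg (k-1)) (d k)"
      "\<forall>k\<ge>1. kern n (r (k-1)) (r k) (d k) = img n (r k) (r (k+1)) (d (k+1))"
      "\<forall>k\<ge>1. \<forall>j<r (k-1). \<forall>i<r k. \<not> nonzero_const (d k j i)"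
      using assms unfolding minimal_graded_free_res_def graded_free_res_def minimal_cx_def
      by blast+
    show "graded_map n (r (Suc k)) (dg (Suc k)) (r k) (dg k) (d (Suc k))"
      "kern n (r k) (r (Suc k)) (d (Suc k)) = img n (r (Suc k)) (r (Suc (Suc k))) (d (Suc (Suc k)))"
      "\<forall>j<r k. \<forall>i<r (Suc k). \<not> nonzero_const (d (Suc k) j i)"
      using *[rule_format, of "Suc k"] by simp_all
  qed
  show "img n (r 0) (r (Suc 0)) (d (Suc 0)) = U"
    using assms unfolding minimal_graded_free_res_def graded_free_res_def by simp
  show "kern n (r k) (r (Suc k)) (d (Suc k)) = img n (r (Suc k)) (r (Suc (Suc k))) (d (Suc (Suc k)))" for k
    by (rule e)
  fix k j i assume ji: "j < r k" "i < r (Suc k)"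
  show "d (Suc k) j i \<in> polys n"
    and h: "homog (d (Suc k) j i) (dg (Suc k) i - dg k j)"
    using g[of k] ji unfolding graded_map_def by blast+
  show "lkp (d (Suc k) j i) 0 = 0"
    using m ji nonzero_const_homog_iff[OF h] by blast
qed

text \<open>Each column of d''_2 is a syzygy of the generators. Conversely a syzygy is d''_2 of some
  vector, so it has no constant terms because d''_2 is minimal; this provides
  \<open>gens_minimal\<close>.\<close>

lemma frob_ideal_syzygies:
  fixes d :: "nat \<Rightarrow> ('k::field) mmat"
  assumes q_pos: "q > 0" and l_le: "l \<le> n"
    and F: "cyclic_res n r dg d (frob_ideal n l q a)"
    and j: "j < r (Suc 0)" and i: "i < r (Suc (Suc 0))" and m: "m \<in> kys (d (Suc (Suc 0)) j i)"
  shows "\<exists>t<l. q \<le> lkp m t"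
proof -
  define A where "A = (frob_ideal n l q a :: 'k mpoly set)"
  note r_0 = cyclic_res_D(1)[OF F]
  note res = minimal_res_D[OF cyclic_res_D(3)[OF F]]
  have A: "is_ideal n A"
    unfolding A_def using l_le by (rule is_ideal_frob)
  have img_iff: "w \<in> vecs n (r (Suc 0)) \<Longrightarrow> (\<Sum>u<r (Suc 0). d (Suc 0) 0 u * w u) \<in> A" for w
  proof -
    assume "w \<in> vecs n (r (Suc 0))"
    then have "mat_app (r 0) (r (Suc 0)) (d (Suc 0)) w \<in> ideal_vecs n A"
      unfolding A_def res(4)[symmetric] img_def by blast
    then show ?thesis
      by (simp add: ideal_vecs_def mat_app_def r_0)
  qed
  show ?thesis
  proof (rule syzygy_keys[OF q_pos l_le])
    show "\<exists>w\<in>vecs n (r (Suc 0)). f = (\<Sum>u<r (Suc 0). d (Suc 0) 0 u * w u)"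
      if "f \<in> frob_ideal n l q a" for f
    proof -
      have "f \<in> polys n"
        using that A unfolding A_def is_ideal_def by blast
      then have "(\<lambda>i. if i = 0 then f else 0) \<in> ideal_vecs n A"
        using that by (simp add: ideal_vecs_def vecs_def A_def)
      then obtain w where w: "w \<in> vecs n (r (Suc 0))"
        "(\<lambda>i. if i = 0 then f else 0) = mat_app (r 0) (r (Suc 0)) (d (Suc 0)) w"
        unfolding A_def res(4)[symmetric] img_def by blast
      have "f = (\<Sum>u<r (Suc 0). d (Suc 0) 0 u * w u)"
        using fun_cong[OF w(2), of 0] by (simp add: mat_app_def r_0)
      then show ?thesis
        using w(1) by blast
    qed
    show "d (Suc 0) 0 u \<in> frob_ideal n l q a" if "u < r (Suc 0)" for u
    proof -
      have "(\<lambda>t. if t = u then 1 else 0) \<in> vecs n (r (Suc 0))"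
        using that by (simp add: vecs_def)
      from img_iff[OF this] show ?thesis
        using that by (simp add: A_def if_distrib[of "\<lambda>x. _ * x"] cong: if_cong)
    qed
    show "homog (d (Suc 0) 0 u) (dg (Suc 0) u - dg 0 0)" if "u < r (Suc 0)" for u
      using res(2)[of 0 0 u] that by (simp add: r_0)
    show "lkp (w u) 0 = 0"
      if "w \<in> vecs n (r (Suc 0))" "(\<Sum>u<r (Suc 0). d (Suc 0) 0 u * w u) = 0" "u < r (Suc 0)" for w u
    proof -
      have "w \<in> kern n (r 0) (r (Suc 0)) (d (Suc 0))"
        using that(1,2) by (intro kernI) (simp_all add: mat_app_def r_0)
      then obtain x where "w = mat_app (r (Suc 0)) (r (Suc (Suc 0))) (d (Suc (Suc 0))) x"
        unfolding res(3) img_def by blast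
      then show ?thesis
        using that(3) by (simp add: mat_app_def lookup_sum lookup_mult_0 res(5))
    qed
    define v where "v = (\<lambda>j. if j < r (Suc 0) then d (Suc (Suc 0)) j i else 0)"
    have v: "v = mat_app (r (Suc 0)) (r (Suc (Suc 0))) (d (Suc (Suc 0))) (\<lambda>t. if t = i then 1 else 0)"
      using i by (auto simp: v_def mat_app_def if_distrib[of "\<lambda>x. _ * x"] cong: if_cong)
    have "(\<lambda>t. if t = i then 1 else 0) \<in> vecs n (r (Suc (Suc 0)))"
      using i by (simp add: vecs_def)
    then have "v \<in> kern n (r 0) (r (Suc 0)) (d (Suc 0))"
      unfolding res(3) img_def v by blast
    then have v: "v \<in> vecs n (r (Suc 0))" "mat_app (r 0) (r (Suc 0)) (d (Suc 0)) v = (\<lambda>_. 0)"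
      by (auto simp: kern_def)
    show "v \<in> vecs n (r (Suc 0))" by (rule v)
    show "(\<Sum>u<r (Suc 0). d (Suc 0) 0 u * v u) = 0"
      using fun_cong[OF v(2), of 0] by (simp add: mat_app_def r_0)
    show "j < r (Suc 0)" by (rule j)
    show "m \<in> kys (v j)"
      using m j by (simp add: v_def)
  qed
qed

section \<open>Special ideals\<close>

lemma var_power_frob: "i < l \<Longrightarrow> var i ^ (p * a) \<in> (frob_ideal n l p a :: ('k::field) mpoly set)"
proof (induction a)
  case 0
  show ?case by (simp add: frob_ideal_def)
next
  case (Suc a)
  have "var i ^ p \<in> ideal_gen n {var i ^ p :: 'k mpoly | i. i < l}"
    using Suc.prems by (auto intro: ideal_gen_base)
  then have "var i ^ p * var i ^ (p * a) \<in> (frob_ideal n l p (Suc a) :: 'k mpoly set)"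
    using Suc unfolding frob_ideal_def ideal_pow.simps by (intro ideal_mult_mem) auto
  then show ?case
    by (simp only: mult_Suc_right power_add)
qed

lemma is_ideal_J:
  assumes "\<And>j. 1 \<le> j \<Longrightarrow> j \<le> Suc k \<Longrightarrow> l j \<le> n"
  shows "is_ideal n (J_ideal n l p a (Suc k) :: ('k::field) mpoly set)"
  using assms
proof (induction k)
  case 0
  then show ?case by (simp add: is_ideal_frob)
next
  case (Suc k)
  have "is_ideal n (J_ideal n l p a (Suc k) :: 'k mpoly set)"
    by (rule Suc.IH) (use Suc.prems in simp)
  moreover have "is_ideal n
      (frob_ideal n (l (Suc (Suc k))) (p (Suc (Suc k))) (a (Suc (Suc k))) :: 'k mpoly set)"
    by (rule is_ideal_frob) (use Suc.prems in simp)
  ultimately show ?case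
    unfolding J_ideal.simps by (intro is_ideal_mult) (simp_all add: is_ideal_def)
qed

text \<open>One pure power of x_i is taken from each factor, so the variable has to occur in all of
  them.\<close>

lemma var_power_J:
  assumes "\<And>j. 1 \<le> j \<Longrightarrow> j \<le> Suc k \<Longrightarrow> i < l j"
  shows "var i ^ (\<Sum>j=1..Suc k. p j * a j) \<in> (J_ideal n l p a (Suc k) :: ('k::field) mpoly set)"
  using assms
proof (induction k)
  case 0
  then show ?case by (simp add: var_power_frob)
next
  case (Suc k)
  have "var i ^ (\<Sum>j=1..Suc k. p j * a j) \<in> (J_ideal n l p a (Suc k) :: 'k mpoly set)"
    by (rule Suc.IH) (use Suc.prems in simp)
  moreover have "var i ^ (p (Suc (Suc k)) * a (Suc (Suc k))) \<in>
      (frob_ideal n (l (Suc (Suc k))) (p (Suc (Suc k))) (a (Suc (Suc k))) :: 'k mpoly set)"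
    by (rule var_power_frob) (use Suc.prems in simp)
  ultimately have "var i ^ (p (Suc (Suc k)) * a (Suc (Suc k))) * var i ^ (\<Sum>j=1..Suc k. p j * a j)
      \<in> (J_ideal n l p a (Suc (Suc k)) :: 'k mpoly set)"
    unfolding J_ideal.simps by (intro ideal_mult_mem)
  moreover have "(\<Sum>j=1..Suc (Suc k). p j * a j) =
      p (Suc (Suc k)) * a (Suc (Suc k)) + (\<Sum>j=1..Suc k. p j * a j)"
    by simp
  ultimately show ?case
    by (simp only: power_add)
qed

section \<open>Numerical conditions of special ideals\<close>

lemma special_data_mono:
  assumes "special_data n s l p a" "1 \<le> i" "i \<le> j" "j \<le> s"
  shows "l j \<le> l i"
  using assms(3,4)
proof (induction j rule: dec_induct)
  case (step j)
  then have "l (j + 1) \<le> l j"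
    using assms(1,2) by (simp add: special_data_def)
  then show ?case using step by simp
qed simp

text \<open>Multiply \<open>a j + 1 \<le> p (j + 1) div p j\<close> by \<open>p j\<close>. The spare
  summand \<open>p j\<close> is what absorbs all earlier terms in the next lemma.\<close>

lemma special_data_step:
  assumes "special_data n s l p a" "1 \<le> j" "j < s"
  shows "p j + p j * a j \<le> p (Suc j)"
proof -
  have j: "p j dvd p (j + 1)" "a j < p (j + 1) div p j"
    using assms by (simp_all add: special_data_def)
  have "p j * Suc (a j) \<le> p j * (p (j + 1) div p j)"
    using j(2) by (intro mult_le_mono2) simp
  then show ?thesis
    using j(1) by simp
qed

lemma special_data_sum_less:
  assumes special: "special_data n s l p a" and "Suc k < s"
  shows "(\<Sum>j=1..Suc k. p j * a j) < p (Suc (Suc k))"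
  using assms(2)
proof (induction k)
  case 0
  then have "1 < s" "p 1 > 0"
    using special by (simp_all add: special_data_def)
  then show ?case
    using special_data_step[OF special, of 1] by simp
next
  case (Suc k)
  have "(\<Sum>j=1..Suc k. p j * a j) < p (Suc (Suc k))"
    using Suc by simp
  moreover have "p (Suc (Suc k)) + p (Suc (Suc k)) * a (Suc (Suc k)) \<le> p (Suc (Suc (Suc k)))"
    using special_data_step[OF special, of "Suc (Suc k)"] Suc.prems by simp
  ultimately show ?case by simp
qed

text \<open>A/AB is represented as F_1 modulo the preimage of AB under d''_1, so its augmentation is
  the one induced by d''_1.\<close>

theorem theorem3p5:
  fixes n s :: nat and l p a :: "nat \<Rightarrow> nat" and k :: nat
    and fr gr :: "nat \<Rightarrow> nat" and fdg gdg :: "nat \<Rightarrow> nat \<Rightarrow> int"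
    and d2 d1 lam :: "nat \<Rightarrow> ('k::field) mmat"
  assumes special: "special_data n s l p a"
    and k: "2 \<le> k" "k \<le> s"
    and F: "cyclic_res n fr fdg d2 (frob_ideal n (l k) (p k) (a k) :: 'k mpoly set)"
    and G0: "gr 0 = fr 1" "gdg 0 = fdg 1"
    and G: "minimal_graded_free_res n gr gdg d1
              {v \<in> vecs n (fr 1). mat_app 1 (fr 1) (d2 1) v 0 \<in>
                 ideal_mult n (frob_ideal n (l k) (p k) (a k)) (J_ideal n l p a (k-1))}"
    and lam: "horseshoe_maps n fr fdg d2 gr gdg d1 lam"
  shows "minimal_graded_free_res n (rh_rank fr gr) (rh_deg fdg gr gdg) (rh_diff fr d2 gr d1 lam)
           (ideal_vecs n (J_ideal n l p a k))"
proof -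
  define A where "A = (frob_ideal n (l k) (p k) (a k) :: 'k mpoly set)"
  define B where "B = (J_ideal n l p a (k - 1) :: 'k mpoly set)"
  obtain k' where k': "k = Suc (Suc k')"
    using k(1) by (metis add_2_eq_Suc le_Suc_ex)
  have l_le: "l j \<le> n" if "1 \<le> j" "j \<le> s" for j
    using special_data_mono[OF special _ that] special by (simp add: special_data_def)
  have q_pos: "p k > 0"
    using special k by (simp add: special_data_def)
  have A: "is_ideal n A"
    unfolding A_def by (rule is_ideal_frob) (use l_le k in simp)
  have B: "is_ideal n B"
    unfolding B_def k' diff_Suc_1 by (rule is_ideal_J) (use l_le k in \<open>simp add: k'\<close>)
  have B_polys: "B \<subseteq> polys n" and A_polys: "A \<subseteq> polys n"
    using A B by (simp_all add: is_ideal_def)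
  have AB: "is_ideal n (ideal_mult n A B)"
    using A_polys B_polys by (rule is_ideal_mult)
  have AB_A: "ideal_mult n A B \<subseteq> A"
    using A B_polys by (rule ideal_mult_subset_left)
  have J: "J_ideal n l p a k = ideal_mult n A B"
    by (simp add: k' A_def B_def)
  have power_B: "var t ^ (p k - 1) \<in> B" if "t < l k" for t
  proof -
    \<comment> \<open>The \<open>l j\<close> decrease, so a variable of the last factor occurs in
      all earlier ones.\<close>
    have "t < l j" if "1 \<le> j" "j \<le> Suc k'" for j
      using special_data_mono[OF special that(1), of k] that k \<open>t < l k\<close> by (simp add: k')
    then have "var t ^ (\<Sum>j=1..Suc k'. p j * a j) \<in> B"
      unfolding B_def k' diff_Suc_1 by (rule var_power_J)
    moreover have "var t ^ (p k - 1 - (\<Sum>j=1..Suc k'. p j * a j)) \<in> (polys n :: 'k mpoly set)"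
      using that l_le[of k] k by (intro polys_power polys_var) simp
    ultimately have "var t ^ (p k - 1 - (\<Sum>j=1..Suc k'. p j * a j)) * var t ^ (\<Sum>j=1..Suc k'. p j * a j) \<in> B"
      using B unfolding is_ideal_def by blast
    moreover have "(\<Sum>j=1..Suc k'. p j * a j) \<le> p k - 1"
      using special_data_sum_less[OF special, of k'] k by (simp add: k')
    ultimately show ?thesis
      by (simp only: power_add[symmetric] le_add_diff_inverse2)
  qed
  note fr_0 = cyclic_res_D(1)[OF F] and fdg_0 = cyclic_res_D(2)[OF F]
  note resF = minimal_res_D[OF cyclic_res_D(3)[OF F], folded A_def]
  note resG = minimal_res_D[OF G, folded A_def B_def]
  have lam': "graded_map n (fr (Suc k)) (fdg (Suc k)) (gr k) (gdg k) (lam (Suc k))" for k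
    using lam[unfolded horseshoe_maps_def, THEN conjunct1, rule_format, of "Suc k"] by simp
  have lam_polys: "lam (Suc k) j i \<in> polys n"
    and lam_homog: "homog (lam (Suc k) j i) (fdg (Suc k) i - gdg k j)"
    if "j < gr k" "i < fr (Suc k)" for k j i
    using lam'[of k] that unfolding graded_map_def by blast+
  interpret horseshoe n fr gr d2 d1 lam
  proof
    show "gr 0 = fr (Suc 0)" using G0 by simp
    show "lam (Suc 0) j i = (if j = i then - 1 else 0)" if "j < fr (Suc 0)" "i < fr (Suc 0)" for j i
      using lam that by (simp add: horseshoe_maps_def)
    show "mat_mult (gr (Suc k)) (d1 (Suc k)) (lam (Suc (Suc k))) j i =
        - mat_mult (fr (Suc k)) (lam (Suc k)) (d2 (Suc (Suc k))) j i"
      if "j < gr k" "i < fr (Suc (Suc k))" for k j i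
    proof -
      have "\<forall>k>1. \<forall>j<gr (k-2). \<forall>i<fr k.
          mat_mult (gr (k-1)) (d1 (k-1)) (lam k) j i + mat_mult (fr (k-1)) (lam (k-1)) (d2 k) j i = 0"
        using lam unfolding horseshoe_maps_def by blast
      from this[rule_format, of "Suc (Suc k)" j i] that show ?thesis
        by (simp add: add_eq_0_iff2)
    qed
  qed (fact resF(1) resG(1) resF(3) resG(3) lam_polys)+
  have gens_A: "d2 (Suc 0) 0 u \<in> A" if "u < fr (Suc 0)" for u
  proof -
    define e :: "'k mvec" where "e = (\<lambda>t. if t = u then 1 else 0)"
    have "e \<in> vecs n (fr (Suc 0))"
      using that by (simp add: e_def vecs_def)
    then have "mat_app (fr 0) (fr (Suc 0)) (d2 (Suc 0)) e \<in> ideal_vecs n A"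
      unfolding resF(4)[symmetric] img_def by blast
    then show ?thesis
      using that by (simp add: ideal_vecs_def mat_app_def fr_0 e_def if_distrib[of "\<lambda>x. _ * x"] cong: if_cong)
  qed
  interpret minimal_horseshoe n fr gr d2 d1 lam "p k" "l k"
  proof
    show "p k > 0" by (rule q_pos)
    show "l k \<le> n" using l_le k by simp
    show "lkp (d2 (Suc k) j i) 0 = 0" if "j < fr k" "i < fr (Suc k)" for k j i
      using that by (rule resF(5))
    show "lkp (d1 (Suc k) j i) 0 = 0" if "j < gr k" "i < gr (Suc k)" for k j i
      using that by (rule resG(5))
    show "\<exists>t<l k. p k \<le> lkp m t"
      if "j < fr (Suc 0)" "i < fr (Suc (Suc 0))" "m \<in> kys (d2 (Suc (Suc 0)) j i)" for j i m
      by (rule frob_ideal_syzygies[OF q_pos _ F that]) (use l_le k in simp)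
    show "(\<lambda>j. if j = u then var t ^ (p k - 1) else 0) \<in> img n (gr 0) (gr (Suc 0)) (d1 (Suc 0))"
      if t: "t < l k" and u: "u < fr (Suc 0)" for t u
    proof -
      define e :: "'k mvec" where "e = (\<lambda>j. if j = u then var t ^ (p k - 1) else 0)"
      have "t < n"
        using t l_le[of k] k by simp
      then have "e \<in> vecs n (fr 1)"
        using u by (auto simp: vecs_def e_def)
      \<comment> \<open>The generator lies in \<open>A\<close> and the power in \<open>B\<close>, so
        the vector lies in the preimage of the product ideal.\<close>
      moreover have "mat_app 1 (fr 1) (d2 1) e 0 = d2 1 0 u * var t ^ (p k - 1)"
        using u by (simp add: mat_app_def e_def if_distrib[of "\<lambda>x. _ * x"] cong: if_cong)
      then have "mat_app 1 (fr 1) (d2 1) e 0 \<in> ideal_mult n A B"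
        using ideal_mult_mem[OF gens_A[OF u] power_B[OF t]] by simp
      ultimately show ?thesis
        unfolding resG(4) e_def[symmetric] by blast
    qed
  qed
  have graded: "graded_map n (hr (Suc k)) (rh_deg fdg gr gdg (Suc k)) (hr k) (rh_deg fdg gr gdg k) (H (Suc k))"
    and minimal: "\<forall>j<hr k. \<forall>i<hr (Suc k). lkp (H (Suc k) j i) 0 = 0" for k
  proof -
    \<comment> \<open>The three shapes of \<open>rh_diff\<close>: a product in degree 1, a single
      block row in degree 2, the full cone from degree 3 on.\<close>
    consider "k = 0" | "k = Suc 0" | k' where "k = Suc (Suc k')"
      by (metis not0_implies_Suc)
    then have "(\<forall>j<hr k. \<forall>i<hr (Suc k). H (Suc k) j i \<in> polys n \<and>
        homog (H (Suc k) j i) (rh_deg fdg gr gdg (Suc k) i - rh_deg fdg gr gdg k j) \<and>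
        lkp (H (Suc k) j i) 0 = 0)"
    proof cases
      case 1
      have "H (Suc 0) 0 i \<in> polys n \<and> homog (H (Suc 0) 0 i) (gdg 1 i) \<and> lkp (H (Suc 0) 0 i) 0 = 0"
        if i: "i < gr (Suc 0)" for i
      proof -
        have H: "H (Suc 0) 0 i = - (\<Sum>u<fr (Suc 0). d2 (Suc 0) 0 u * d1 (Suc 0) u i)"
          by (simp add: rh_diff_def mat_mult_def)
        have d: "d2 (Suc 0) 0 u \<in> polys n" "homog (d2 (Suc 0) 0 u) (fdg 1 u)"
          "lkp (d2 (Suc 0) 0 u) 0 = 0" if "u < fr (Suc 0)" for u
          using resF(1,2,5)[of 0 0 u] that by (simp_all add: fr_0 fdg_0)
        have d': "d1 (Suc 0) u i \<in> polys n" "homog (d1 (Suc 0) u i) (gdg 1 i - fdg 1 u)"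
          if "u < fr (Suc 0)" for u
          using resG(1,2)[of u 0 i] that i by (simp_all add: G0)
        have "homog (d2 (Suc 0) 0 u * d1 (Suc 0) u i) (gdg 1 i)" if "u < fr (Suc 0)" for u
          using homog_mult[OF d(2)[OF that] d'(2)[OF that]] by simp
        then show ?thesis
          unfolding H using d d' by (auto intro!: polys_sum polys_mult homog_sum simp: lookup_sum lookup_mult_0)
      qed
      then show ?thesis
        by (simp add: 1 rh_rank_def rh_deg_def)
    next
      case 2
      have "H (Suc (Suc 0)) j i = (if i < gr (Suc (Suc 0)) then d1 (Suc (Suc 0)) j i
          else lam (Suc (Suc 0)) j (i - gr (Suc (Suc 0))))" for j i
        by (simp add: rh_diff_def numeral_2_eq_2)
      then show ?thesis
        using resG(1,2,5)[of _ "Suc 0"] lam_polys[of _ "Suc 0"] lam_homog[of _ "Suc 0"] lam_minimal[of _ 0]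
        by (simp add: 2 rh_rank_def rh_deg_def)
    next
      case (3 k')
      have H: "H (Suc (Suc (Suc k'))) j i =
        (if j < gr (Suc (Suc k')) then (if i < gr (Suc (Suc (Suc k'))) then d1 (Suc (Suc (Suc k'))) j i
             else lam (Suc (Suc (Suc k'))) j (i - gr (Suc (Suc (Suc k')))))
         else (if i < gr (Suc (Suc (Suc k'))) then 0
           else d2 (Suc (Suc (Suc k'))) (j - gr (Suc (Suc k'))) (i - gr (Suc (Suc (Suc k'))))))" for j i
        by (simp add: rh_diff_def)
      show ?thesis
        using resG(1,2,5)[of _ "Suc (Suc k')"] resF(1,2,5)[of _ "Suc (Suc k')"]
          lam_polys[of _ "Suc (Suc k')"] lam_homog[of _ "Suc (Suc k')"] lam_minimal[of _ "Suc k'"]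
        by (simp add: 3 rh_rank_def rh_deg_def H)
    qed
    then show "graded_map n (hr (Suc k)) (rh_deg fdg gr gdg (Suc k)) (hr k) (rh_deg fdg gr gdg k) (H (Suc k))"
      "\<forall>j<hr k. \<forall>i<hr (Suc k). lkp (H (Suc k) j i) 0 = 0"
      unfolding graded_map_def by blast+
  qed
  have hr: "hr 0 = Suc 0" "hr (Suc 0) = gr (Suc 0)"
    by (simp_all add: rh_rank_def)
  have image: "img n (hr 0) (hr (Suc 0)) (H (Suc 0)) = ideal_vecs n (ideal_mult n A B)"
  proof (intro equalityI subsetI)
    fix x assume "x \<in> img n (hr 0) (hr (Suc 0)) (H (Suc 0))"
    then obtain v where v: "v \<in> vecs n (gr (Suc 0))" "x = mat_app (hr 0) (hr (Suc 0)) (H (Suc 0)) v"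
      unfolding img_def hr by blast
    have "dG 0 v \<in> img n (gr 0) (gr (Suc 0)) (d1 (Suc 0))"
      using v(1) unfolding dG_def img_def by blast
    then have "dF 0 (dG 0 v) 0 \<in> ideal_mult n A B"
      unfolding resG(4) by (simp add: dF_def fr_0)
    then have "x 0 \<in> ideal_mult n A B"
      unfolding v(2) H_1[OF fr_0] by (rule is_ideal_uminus[OF AB])
    moreover have "x i = 0" if "i > 0" for i
      using that by (simp add: v(2) mat_app_def hr)
    ultimately show "x \<in> ideal_vecs n (ideal_mult n A B)"
      using AB by (auto simp: mem_ideal_vecs_iff is_ideal_def)
  next
    fix x assume x: "x \<in> ideal_vecs n (ideal_mult n A B)"
    \<comment> \<open>AB is contained in \<open>A\<close>, so \<open>x\<close> has a preimage in
      F_1. Its negative is used from here on, to match the sign of lambda_1.\<close>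
    then have "x \<in> ideal_vecs n A"
      using AB_A by (auto simp: mem_ideal_vecs_iff)
    then obtain w where w: "w \<in> vecs n (fr (Suc 0))" "x = dF 0 w"
      unfolding resF(4)[symmetric] img_def dF_def by blast
    have "dF 0 (\<lambda>i. - w i) 0 = - x 0"
      unfolding w(2) dF_def by (rule mat_app_uminus)
    moreover have "- x 0 \<in> ideal_mult n A B"
      using x by (intro is_ideal_uminus[OF AB]) (simp add: mem_ideal_vecs_iff)
    ultimately have "(\<lambda>i. - w i) \<in> img n (gr 0) (gr (Suc 0)) (d1 (Suc 0))"
      unfolding resG(4) using vecs_uminus[OF w(1)] by (simp add: dF_def fr_0)
    then obtain v where v: "v \<in> vecs n (gr (Suc 0))" "(\<lambda>i. - w i) = dG 0 v"
      unfolding img_def dG_def by blast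
    have "x = mat_app (hr 0) (hr (Suc 0)) (H (Suc 0)) v"
    proof
      fix j
      show "x j = mat_app (hr 0) (hr (Suc 0)) (H (Suc 0)) v j"
        unfolding H_1[OF fr_0] v(2)[symmetric] w(2) dF_def mat_app_uminus by simp
    qed
    then show "x \<in> img n (hr 0) (hr (Suc 0)) (H (Suc 0))"
      unfolding img_def hr using v(1) by blast
  qed
  have Suc_ex: "\<exists>m. k = Suc m" if "k \<ge> 1" for k :: nat
    using that by (cases k) auto
  have "graded_free_res n hr (rh_deg fdg gr gdg) H (ideal_vecs n (J_ideal n l p a k))"
    unfolding graded_free_res_def J
  proof (intro conjI allI impI)
    fix k :: nat assume "1 \<le> k"
    then obtain m where m: "k = Suc m"
      using Suc_ex by blast
    show "graded_map n (hr k) (rh_deg fdg gr gdg k) (hr (k - 1)) (rh_deg fdg gr gdg (k - 1)) (H k)"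
      using graded[of m] by (simp only: m diff_Suc_1)
    show "kern n (hr (k - 1)) (hr k) (H k) = img n (hr k) (hr (k + 1)) (H (k + 1))"
      using H_exact[OF fr_0, of m] by (simp add: m)
  qed (use image in simp)
  moreover have "minimal_cx hr H"
    unfolding minimal_cx_def
  proof (intro allI impI)
    fix k j i assume "1 \<le> k" "j < hr (k - 1)" "i < hr k"
    moreover obtain m where m: "k = Suc m"
      using Suc_ex \<open>1 \<le> k\<close> by blast
    ultimately have "homog (H k j i) (rh_deg fdg gr gdg k i - rh_deg fdg gr gdg (k - 1) j)"
      "lkp (H k j i) 0 = 0"
      using graded[of m] minimal[of m] by (simp_all add: graded_map_def)
    then show "\<not> nonzero_const (H k j i)"
      using nonzero_const_homog_iff by blast
  qed
  ultimately show ?thesis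
    unfolding minimal_graded_free_res_def by blast
qed

end
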